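(* Let $\sigma\in\mathbb{P}$, $m,k\in\mathbb{M}$ with $k\leq|n|^c$ for some standard $c$, and let $A$ be an $(m,k,\sigma)$-WPHP-array. Then there exist $k'\in\mathbb{M}$ with $k\leq k'\leq|n|^{c'}$ for a suitable standard $c'$ and a $k'$-uniform $(m,k',\sigma)$-WPHP-array of size $N\geq 2m\cdot\frac{(n-|\sigma|)!}{(n-|\sigma|-k')!}$.
   Context: $\mathbb{M}$ is a countable nonstandard model of true arithmetic (in the language with $0,1,\lfloor x/2\rfloor,|x|$ (bit-length), $+,\cdot,\#,<$), $n\in\mathbb{M}$ is nonstandard, $[x]=\{y\in\mathbb{M}:y<x\}$. $\mathbb{P}$ is the set of partial injective functions $\sigma\in\mathbb{M}$ from $[n+1]$ to $[n]$ with $|\sigma|\leq|n|^c$ for some standard $c$ ($|\sigma|$ = number of pairs); $\tau\leq\sigma$ means $\tau\supseteq\sigma$; $\sigma,\tau$ compatible ($\sigma\|\tau$) iff $\sigma\cup\tau\in\mathbb{P}$, otherwise incompatible ($\sigma\perp\tau$). All objects below are elements of $\mathbb{M}$ and counting is done in $\mathbb{M}$. An $(m,k,\sigma)$-WPHP-array (for $\sigma\in\mathbb{P}$, $m,k\in\mathbb{M}$, $k\leq|n|^c$ standard $c$) is an array $A\in\mathbb{M}$ indexed by $[2m]\times[m]$ whose entries are sets of conditions of size at most $k$, each condition $\tau$ in an entry being compatible with $\sigma$ and satisfying $\tau\cap\sigma=\emptyset$, such that: (1) for $a\neq a'\in[2m]$, $b\neq b'\in[m]$: $A(a,b)\cap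 A(a',b)=A(a,b)\cap A(a,b')=\emptyset$; (2) for all $a,a'\in[2m]$, $b\in[m]$, $\tau\in A(a,b)$, $\tau'\in A(a',b)$: $\tau\neq\tau'\to\tau\perp\tau'$; (3) for all $a\in[2m]$, $b,b'\in[m]$, $\tau\in A(a,b)$, $\tau'\in A(a,b')$: $\tau\neq\tau'\to\tau\perp\tau'$; (4) for every $\rho\leq\sigma$ in $\mathbb{P}$ and every $a\in[2m]$ there are $b\in[m]$ and $\tau\in A(a,b)$ with $\tau\|\rho$. The size of $A$ is $N=\sum_{a,b}|A(a,b)|$. $A$ is $k'$-uniform if all conditions in $\bigcup_{a,b}A(a,b)$ have size exactly $k'$. *)

theory Defs
  imports Main "HOL-Library.Countable_Set" "HOL-Library.Log_Nat"
begin

section \<open>True arithmetic and its models\<close>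

record 'm arith =
  Zero :: "'m" ("\<zero>\<index>")
  One  :: "'m" ("\<one>\<index>")
  Half :: "'m \<Rightarrow> 'm" ("half\<index> _" [81] 80)
  Len  :: "'m \<Rightarrow> 'm" ("len\<index> _" [81] 80)
  Add  :: "'m \<Rightarrow> 'm \<Rightarrow> 'm" (infixl "\<oplus>\<index>" 65)
  Mul  :: "'m \<Rightarrow> 'm \<Rightarrow> 'm" (infixl "\<otimes>\<index>" 70)
  Smash :: "'m \<Rightarrow> 'm \<Rightarrow> 'm" (infixl "\<sharp>\<index>" 75)
  Less :: "'m \<Rightarrow> 'm \<Rightarrow> bool" (infix "\<sqsubset>\<index>" 50)

definition std_arith :: "nat arith" where
  "std_arith = \<lparr> Zero = 0, One = 1, Half = (\<lambda>x. x div 2), Len = (\<lambda>x. nat (bitlen (int x))),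
     Add = (+), Mul = (*), Smash = (\<lambda>x y. 2 ^ (nat (bitlen (int x)) * nat (bitlen (int y)))),
     Less = (<) \<rparr>"

datatype tm = TVar nat | TZero | TOne | THalf tm | TLen tm
  | TAdd tm tm | TMul tm tm | TSmash tm tm

datatype fm = FEq tm tm | FLess tm tm | FNeg fm | FConj fm fm | FAll nat fm

primrec tval :: "'m arith \<Rightarrow> (nat \<Rightarrow> 'm) \<Rightarrow> tm \<Rightarrow> 'm" where
  "tval M e (TVar i) = e i"
| "tval M e TZero = Zero M"
| "tval M e TOne = One M"
| "tval M e (THalf t) = Half M (tval M e t)"
| "tval M e (TLen t) = Len M (tval M e t)"
| "tval M e (TAdd s t) = Add M (tval M e s) (tval M e t)"
| "tval M e (TMul s t) = Mul M (tval M e s) (tval M e t)"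
| "tval M e (TSmash s t) = Smash M (tval M e s) (tval M e t)"

primrec sat :: "'m arith \<Rightarrow> (nat \<Rightarrow> 'm) \<Rightarrow> fm \<Rightarrow> bool" where
  "sat M e (FEq s t) \<longleftrightarrow> tval M e s = tval M e t"
| "sat M e (FLess s t) \<longleftrightarrow> Less M (tval M e s) (tval M e t)"
| "sat M e (FNeg \<phi>) \<longleftrightarrow> \<not> sat M e \<phi>"
| "sat M e (FConj \<phi> \<psi>) \<longleftrightarrow> sat M e \<phi> \<and> sat M e \<psi>"
| "sat M e (FAll i \<phi>) \<longleftrightarrow> (\<forall>a. sat M (e(i := a)) \<phi>)"

primrec tm_vars :: "tm \<Rightarrow> nat set" where
  "tm_vars (TVar i) = {i}"
| "tm_vars TZero = {}"
| "tm_vars TOne = {}"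
| "tm_vars (THalf t) = tm_vars t"
| "tm_vars (TLen t) = tm_vars t"
| "tm_vars (TAdd s t) = tm_vars s \<union> tm_vars t"
| "tm_vars (TMul s t) = tm_vars s \<union> tm_vars t"
| "tm_vars (TSmash s t) = tm_vars s \<union> tm_vars t"

primrec free_vars :: "fm \<Rightarrow> nat set" where
  "free_vars (FEq s t) = tm_vars s \<union> tm_vars t"
| "free_vars (FLess s t) = tm_vars s \<union> tm_vars t"
| "free_vars (FNeg \<phi>) = free_vars \<phi>"
| "free_vars (FConj \<phi> \<psi>) = free_vars \<phi> \<union> free_vars \<psi>"
| "free_vars (FAll i \<phi>) = free_vars \<phi> - {i}"

definition holds :: "'m arith \<Rightarrow> fm \<Rightarrow> bool" where
  "holds M \<phi> \<longleftrightarrow> (\<forall>e. sat M e \<phi>)"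

definition true_arithmetic :: "fm set" where
  "true_arithmetic = {\<phi>. free_vars \<phi> = {} \<and> holds std_arith \<phi>}"

definition models_true_arithmetic :: "'m arith \<Rightarrow> bool" where
  "models_true_arithmetic M \<longleftrightarrow> (\<forall>\<phi>\<in>true_arithmetic. holds M \<phi>)"

primrec numeral_in :: "'m arith \<Rightarrow> nat \<Rightarrow> 'm" where
  "numeral_in M 0 = Zero M"
| "numeral_in M (Suc i) = Add M (numeral_in M i) (One M)"

definition nonstandard :: "'m arith \<Rightarrow> 'm \<Rightarrow> bool" where
  "nonstandard M x \<longleftrightarrow> x \<notin> range (numeral_in M)"

text \<open>Powers with a standard exponent.\<close>

primrec pow_std :: "'m arith \<Rightarrow> 'm \<Rightarrow> nat \<Rightarrow> 'm" where
  "pow_std M x 0 = One M"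
| "pow_std M x (Suc c) = Mul M x (pow_std M x c)"


section \<open>Finite sets, functions and counting inside a model\<close>

context
  fixes M :: "'m arith" (structure)
begin

definition le :: "'m \<Rightarrow> 'm \<Rightarrow> bool" where
  "le x y \<longleftrightarrow> x \<sqsubset> y \<or> x = y"

definition seg :: "'m \<Rightarrow> 'm set" where
  "seg x = {y. y \<sqsubset> x}"

text \<open>Every element codes a finite set (in the sense of the model) by Ackermann's coding:
  \<open>x\<close> belongs to \<open>y\<close> iff bit \<open>x\<close> of the binary expansion of \<open>y\<close> is 1.  If \<open>len z = x\<close>,
  then \<open>\<one> \<sharp> z\<close> is two to the power \<open>x\<close>.\<close>

definition elem :: "'m \<Rightarrow> 'm \<Rightarrow> bool" where
  "elem x y \<longleftrightarrow> (\<exists>z u v. len z = x \<and> v \<sqsubset> \<one> \<sharp> z \<and> y = (u \<oplus> u \<oplus> \<one>) \<otimes> (\<one> \<sharp> z) \<oplus> v)"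

definition ext :: "'m \<Rightarrow> 'm set" where
  "ext y = {x. elem x y}"

text \<open>Cantor's pairing function.\<close>

definition pair :: "'m \<Rightarrow> 'm \<Rightarrow> 'm" where
  "pair x y = half ((x \<oplus> y) \<otimes> (x \<oplus> y \<oplus> \<one>)) \<oplus> y"

definition is_fun :: "'m \<Rightarrow> 'm set \<Rightarrow> bool" where
  "is_fun f D \<longleftrightarrow>
     (\<forall>p\<in>ext f. \<exists>x\<in>D. \<exists>y. p = pair x y) \<and> (\<forall>x\<in>D. \<exists>!y. pair x y \<in> ext f)"

definition app :: "'m \<Rightarrow> 'm \<Rightarrow> 'm" where
  "app f x = (THE y. pair x y \<in> ext f)"

text \<open>\<open>card_is y s\<close>: the set coded by \<open>y\<close> has \<open>s\<close> elements, counted in the model.\<close>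

definition card_is :: "'m \<Rightarrow> 'm \<Rightarrow> bool" where
  "card_is y s \<longleftrightarrow> (\<exists>f. is_fun f (ext y) \<and> bij_betw (app f) (ext y) (seg s))"

definition card_le :: "'m \<Rightarrow> 'm \<Rightarrow> bool" where
  "card_le y k \<longleftrightarrow> (\<exists>s. card_is y s \<and> le s k)"

text \<open>\<open>sum_is F x s\<close>: \<open>s\<close> is the sum of the \<open>v\<^sub>i\<close> over \<open>i \<sqsubset> x\<close>, where \<open>F i v\<^sub>i\<close>;
  the witness \<open>g\<close> is the sequence of partial sums, an element of the model.\<close>

definition sum_is :: "('m \<Rightarrow> 'm \<Rightarrow> bool) \<Rightarrow> 'm \<Rightarrow> 'm \<Rightarrow> bool" where
  "sum_is F x s \<longleftrightarrow> (\<exists>g. is_fun g (seg (x \<oplus> \<one>)) \<and> app g \<zero> = \<zero> \<and>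
     (\<forall>i\<in>seg x. \<exists>v. F i v \<and> app g (i \<oplus> \<one>) = app g i \<oplus> v) \<and> app g x = s)"

definition fact_is :: "'m \<Rightarrow> 'm \<Rightarrow> bool" where
  "fact_is x y \<longleftrightarrow> (\<exists>g. is_fun g (seg (x \<oplus> \<one>)) \<and> app g \<zero> = \<one> \<and>
     (\<forall>i\<in>seg x. app g (i \<oplus> \<one>) = app g i \<otimes> (i \<oplus> \<one>)) \<and> app g x = y)"

text \<open>\<open>fact_quot_is d k r\<close>: \<open>k \<le> d\<close> and \<open>r = d! / (d - k)!\<close>.\<close>

definition fact_quot_is :: "'m \<Rightarrow> 'm \<Rightarrow> 'm \<Rightarrow> bool" where
  "fact_quot_is d k r \<longleftrightarrow>
     (\<exists>e p q. e \<oplus> k = d \<and> fact_is d p \<and> fact_is e q \<and> r \<otimes> q = p)"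


section \<open>Conditions\<close>

definition poly_len_bounded :: "'m \<Rightarrow> 'm \<Rightarrow> bool" where
  "poly_len_bounded n k \<longleftrightarrow> (\<exists>c. le k (pow_std M (len n) c))"

definition partial_inj :: "'m \<Rightarrow> 'm \<Rightarrow> bool" where
  "partial_inj n \<sigma> \<longleftrightarrow>
     (\<forall>p\<in>ext \<sigma>. \<exists>i\<in>seg (n \<oplus> \<one>). \<exists>j\<in>seg n. p = pair i j) \<and>
     (\<forall>i j j'. pair i j \<in> ext \<sigma> \<and> pair i j' \<in> ext \<sigma> \<longrightarrow> j = j') \<and>
     (\<forall>i i' j. pair i j \<in> ext \<sigma> \<and> pair i' j \<in> ext \<sigma> \<longrightarrow> i = i')"

definition conds :: "'m \<Rightarrow> 'm set" where
  "conds n = {\<sigma>. partial_inj n \<sigma> \<and> (\<exists>s. card_is \<sigma> s \<and> poly_len_bounded n s)}"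

text \<open>\<open>extends \<tau> \<sigma>\<close> is the order \<open>\<tau> \<le> \<sigma>\<close> on conditions.\<close>

definition extends :: "'m \<Rightarrow> 'm \<Rightarrow> bool" where
  "extends \<tau> \<sigma> \<longleftrightarrow> ext \<sigma> \<subseteq> ext \<tau>"

definition compat :: "'m \<Rightarrow> 'm \<Rightarrow> 'm \<Rightarrow> bool" where
  "compat n \<sigma> \<tau> \<longleftrightarrow> (\<exists>\<rho>\<in>conds n. ext \<rho> = ext \<sigma> \<union> ext \<tau>)"


section \<open>Arrays\<close>

definition entry :: "'m \<Rightarrow> 'm \<Rightarrow> 'm \<Rightarrow> 'm" where
  "entry A a b = app A (pair a b)"

text \<open>The rows are indexed by \<open>a\<close> below \<open>2m\<close>, the columns by \<open>b\<close> below \<open>m\<close>.  The two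
  disjointness clauses are independent of each other (this matters only if \<open>m = 1\<close>).\<close>

definition wphp_array :: "'m \<Rightarrow> 'm \<Rightarrow> 'm \<Rightarrow> 'm \<Rightarrow> 'm \<Rightarrow> bool" where
  "wphp_array n m k \<sigma> A \<longleftrightarrow>
     \<sigma> \<in> conds n \<and> poly_len_bounded n k \<and>
     is_fun A {pair a b | a b. a \<in> seg (m \<oplus> m) \<and> b \<in> seg m} \<and>
     (\<forall>a\<in>seg (m \<oplus> m). \<forall>b\<in>seg m. \<forall>\<tau>\<in>ext (entry A a b).
        \<tau> \<in> conds n \<and> card_le \<tau> k \<and> compat n \<tau> \<sigma> \<and> ext \<tau> \<inter> ext \<sigma> = {}) \<and>
     (\<forall>a\<in>seg (m \<oplus> m). \<forall>a'\<in>seg (m \<oplus> m). \<forall>b\<in>seg m. a \<noteq> a' \<longrightarrow>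
        ext (entry A a b) \<inter> ext (entry A a' b) = {}) \<and>
     (\<forall>a\<in>seg (m \<oplus> m). \<forall>b\<in>seg m. \<forall>b'\<in>seg m. b \<noteq> b' \<longrightarrow>
        ext (entry A a b) \<inter> ext (entry A a b') = {}) \<and>
     (\<forall>a\<in>seg (m \<oplus> m). \<forall>a'\<in>seg (m \<oplus> m). \<forall>b\<in>seg m.
        \<forall>\<tau>\<in>ext (entry A a b). \<forall>\<tau>'\<in>ext (entry A a' b). \<tau> \<noteq> \<tau>' \<longrightarrow> \<not> compat n \<tau> \<tau>') \<and>
     (\<forall>a\<in>seg (m \<oplus> m). \<forall>b\<in>seg m. \<forall>b'\<in>seg m.
        \<forall>\<tau>\<in>ext (entry A a b). \<forall>\<tau>'\<in>ext (entry A a b'). \<tau> \<noteq> \<tau>' \<longrightarrow> \<not> compat n \<tau> \<tau>') \<and>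
     (\<forall>\<rho>\<in>conds n. extends \<rho> \<sigma> \<longrightarrow>
        (\<forall>a\<in>seg (m \<oplus> m). \<exists>b\<in>seg m. \<exists>\<tau>\<in>ext (entry A a b). compat n \<tau> \<rho>))"

definition array_size_is :: "'m \<Rightarrow> 'm \<Rightarrow> 'm \<Rightarrow> bool" where
  "array_size_is m A N \<longleftrightarrow>
     sum_is (\<lambda>a v. sum_is (\<lambda>b. card_is (entry A a b)) m v) (m \<oplus> m) N"

definition uniform :: "'m \<Rightarrow> 'm \<Rightarrow> 'm \<Rightarrow> bool" where
  "uniform m k A \<longleftrightarrow>
     (\<forall>a\<in>seg (m \<oplus> m). \<forall>b\<in>seg m. \<forall>\<tau>\<in>ext (entry A a b). card_is \<tau> k)"

end

end

theory Submission
  imports Defs "HOL-Library.Nat_Bijection"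
begin

text \<open>Work with the pigeons and holes not used by \<open>\<sigma>\<close> and fix a row of the array. The conditions
  in this row are pairwise incompatible, and every small condition is compatible with one of them.
  Build a decision tree: at a node \<open>\<rho>\<close> pick a condition of the row compatible with \<open>\<rho>\<close> and query
  the partners of all its pigeons and holes. Any other condition of the row disagrees with it
  somewhere, so each round decides one more pair of every condition still compatible with the node.
  After at most \<open>k\<close> rounds, with \<open>2k, 2(k - 1), \<dots>, 2\<close> queries (padded by arbitrary ones), every
  leaf contains a condition of the row, and all leaves have size \<open>k' = k(k + 1)\<close>. Distinct leaves are
  incompatible, every condition leaving enough room can be followed to a leaf, and a node at depth
  \<open>i\<close> has at least \<open>n - |\<sigma>| - i\<close> children, which gives the count. Replacing the conditions of the
  row by the leaves that extend them gives the uniform array.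

  Conditions are bounded by a power of \<open>|n|\<close> with standard exponent, which no formula expresses. The
  argument is therefore carried out in the natural numbers with explicit size bounds, where the
  resulting array is complete for all \<open>\<rho>\<close> with \<open>|\<rho>| + k' \<le> n\<close>, and transferred to the model as a
  single first-order sentence; in the model this bound covers every standard exponent, because \<open>n\<close>
  is nonstandard.\<close>

section \<open>Formulas and transfer\<close>

definition FEx :: "nat \<Rightarrow> fm \<Rightarrow> fm" where "FEx i \<phi> = FNeg (FAll i (FNeg \<phi>))"
definition FImp :: "fm \<Rightarrow> fm \<Rightarrow> fm" where "FImp \<phi> \<psi> = FNeg (FConj \<phi> (FNeg \<psi>))"
definition FDisj :: "fm \<Rightarrow> fm \<Rightarrow> fm" where "FDisj \<phi> \<psi> = FNeg (FConj (FNeg \<phi>) (FNeg \<psi>))"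

lemma sat_derived [simp]:
  "sat M e (FEx i \<phi>) \<longleftrightarrow> (\<exists>a. sat M (e(i := a)) \<phi>)"
  "sat M e (FImp \<phi> \<psi>) \<longleftrightarrow> (sat M e \<phi> \<longrightarrow> sat M e \<psi>)"
  "sat M e (FDisj \<phi> \<psi>) \<longleftrightarrow> (sat M e \<phi> \<or> sat M e \<psi>)"
  by (auto simp: FEx_def FImp_def FDisj_def)

lemma finite_tm_vars: "finite (tm_vars t)"
  by (induction t) auto

lemma finite_free_vars: "finite (free_vars \<phi>)"
  by (induction \<phi>) (auto simp: finite_tm_vars)

text \<open>True arithmetic contains sentences only, so the free variables of \<open>\<phi>\<close>
  are first closed off by universal quantifiers. As \<open>e\<close> is arbitrary, elements of
  \<open>M\<close> may serve as parameters.\<close>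

lemma transfer:
  assumes M: "models_true_arithmetic M" and std: "\<And>e. sat std_arith e \<phi>"
  shows "sat M e \<phi>"
proof -
  obtain vs where vs: "set vs = free_vars \<phi>"
    using finite_list[OF finite_free_vars] by metis
  have free: "free_vars (foldr FAll ws \<phi>) = free_vars \<phi> - set ws" for ws
    by (induction ws) auto
  have "sat std_arith e (foldr FAll ws \<phi>)" for ws e
    by (induction ws arbitrary: e) (auto simp: std)
  then have "foldr FAll vs \<phi> \<in> true_arithmetic"
    unfolding true_arithmetic_def holds_def by (simp add: free[of vs] vs)
  then have "sat M e (foldr FAll vs \<phi>)"
    using M by (simp add: models_true_arithmetic_def holds_def)
  moreover have "sat M e \<phi>" if "sat M e (foldr FAll ws \<phi>)" for ws
    using that
  proof (induction ws)
    case (Cons w ws)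
    then have "\<forall>a. sat M (e(w := a)) (foldr FAll ws \<phi>)" by simp
    \<comment> \<open>Instantiating with the value that \<open>e\<close> already gives to
      \<open>w\<close> leaves the assignment unchanged.\<close>
    from spec[OF this, of "e w"] show ?case using Cons.IH by simp
  qed simp
  ultimately show ?thesis by blast
qed

text \<open>An upper bound for the variable indices of a term (constants count as 0); every larger
  index is fresh for it.\<close>

primrec tm_bound :: "tm \<Rightarrow> nat" where
  "tm_bound (TVar i) = i"
| "tm_bound TZero = 0"
| "tm_bound TOne = 0"
| "tm_bound (THalf t) = tm_bound t"
| "tm_bound (TLen t) = tm_bound t"
| "tm_bound (TAdd s t) = max (tm_bound s) (tm_bound t)"
| "tm_bound (TMul s t) = max (tm_bound s) (tm_bound t)"
| "tm_bound (TSmash s t) = max (tm_bound s) (tm_bound t)"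

lemma tval_upd [simp]: "tm_bound t < i \<Longrightarrow> tval M (e(i := a)) t = tval M e t"
  by (induction t) auto

section \<open>Terms and formulas for coded sets, functions and cardinality\<close>

definition TPair :: "tm \<Rightarrow> tm \<Rightarrow> tm" where
  "TPair s t = TAdd (THalf (TMul (TAdd s t) (TAdd (TAdd s t) TOne))) t"

lemma tval_TPair [simp]: "tval M e (TPair s t) = pair M (tval M e s) (tval M e t)"
  by (simp add: TPair_def pair_def)

text \<open>The exponent is a number outside the model, so each standard exponent yields its own
  term.\<close>

primrec TPow :: "tm \<Rightarrow> nat \<Rightarrow> tm" where
  "TPow t 0 = TOne"
| "TPow t (Suc c) = TMul t (TPow t c)"

lemma tval_TPow [simp]: "tval M e (TPow t c) = pow_std M (tval M e t) c"
  by (induction c) auto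

primrec TNum :: "nat \<Rightarrow> tm" where
  "TNum 0 = TZero"
| "TNum (Suc c) = TAdd (TNum c) TOne"

lemma tval_TNum [simp]: "tval M e (TNum c) = numeral_in M c"
  by (induction c) auto

definition FLe :: "tm \<Rightarrow> tm \<Rightarrow> fm" where
  "FLe s t = FDisj (FLess s t) (FEq s t)"

lemma sat_FLe [simp]: "sat M e (FLe s t) \<longleftrightarrow> le M (tval M e s) (tval M e t)"
  by (simp add: FLe_def le_def)

text \<open>Formula constructors take variable indices; their bound variables are numbered above all of
  them, so that no capture occurs and the \<open>sat\<close> equations hold for arbitrary arguments.\<close>

definition FElem :: "nat \<Rightarrow> nat \<Rightarrow> fm" where
  "FElem x y = (let i = Suc (x + y); p = TSmash TOne (TVar i) in
     FEx i (FEx (i + 1) (FEx (i + 2)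
       (FConj (FEq (TLen (TVar i)) (TVar x))
       (FConj (FLess (TVar (i + 2)) p)
         (FEq (TVar y) (TAdd (TMul (TAdd (TAdd (TVar (i + 1)) (TVar (i + 1))) TOne) p) (TVar (i + 2)))))))))"

lemma sat_FElem [simp]: "sat M e (FElem x y) \<longleftrightarrow> e x \<in> ext M (e y)"
  by (simp add: FElem_def Let_def ext_def elem_def)

definition FIn :: "tm \<Rightarrow> nat \<Rightarrow> fm" where
  "FIn t y = (let i = Suc (tm_bound t + y) in FEx i (FConj (FEq (TVar i) t) (FElem i y)))"

lemma sat_FIn [simp]: "sat M e (FIn t y) \<longleftrightarrow> tval M e t \<in> ext M (e y)"
  by (simp add: FIn_def Let_def)

text \<open>The domain enters as a formula scheme because it may be a definable set without a given
  code, such as a segment or a grid. The caller supplies \<open>i\<close>, since the variables of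
  \<open>\<Phi>\<close> are not visible here.\<close>

definition FFun :: "(nat \<Rightarrow> fm) \<Rightarrow> nat \<Rightarrow> nat \<Rightarrow> fm" where
  "FFun \<Phi> f i =
     FConj (FAll i (FImp (FElem i f)
        (FEx (i + 1) (FConj (\<Phi> (i + 1)) (FEx (i + 2) (FEq (TVar i) (TPair (TVar (i + 1)) (TVar (i + 2)))))))))
      (FAll i (FImp (\<Phi> i) (FEx (i + 1) (FConj (FIn (TPair (TVar i) (TVar (i + 1))) f)
        (FAll (i + 2) (FImp (FIn (TPair (TVar i) (TVar (i + 2))) f) (FEq (TVar (i + 2)) (TVar (i + 1)))))))))"

text \<open>\<open>FFun\<close> uses \<open>\<Phi>\<close> at \<open>i\<close> and again at
  \<open>i + 1\<close>, where \<open>i\<close> already holds a pair; hence two assumptions.\<close>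

lemma sat_FFun:
  assumes "\<And>x. sat M (e(i := x)) (\<Phi> i) \<longleftrightarrow> x \<in> D"
    and "\<And>p x. sat M (e(i := p, Suc i := x)) (\<Phi> (Suc i)) \<longleftrightarrow> x \<in> D" and "f < i"
  shows "sat M e (FFun \<Phi> f i) \<longleftrightarrow> is_fun M (e f) D"
proof -
  have "f \<noteq> i" "f \<noteq> Suc i" "f \<noteq> Suc (Suc i)"
    using assms(3) by auto
  then show ?thesis
    unfolding FFun_def is_fun_def Ex1_def Ball_def Bex_def
    by (simp add: assms(1,2))
qed

text \<open>\<open>app\<close> is a definite description, which no term denotes. On the domain its
  equations become membership of a pair, which \<open>FIn\<close> expresses.\<close>

lemma app_eq_iff:
  assumes "is_fun M f D" "x \<in> D"
  shows "app M f x = y \<longleftrightarrow> pair M x y \<in> ext M f"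
proof -
  have ex1: "\<exists>!y. pair M x y \<in> ext M f"
    using assms by (simp add: is_fun_def)
  show ?thesis
    unfolding app_def using theI'[OF ex1] the1_equality[OF ex1] by blast
qed

definition FCard :: "nat \<Rightarrow> nat \<Rightarrow> fm" where
  "FCard y s = (let f = Suc (y + s); i = f + 1 in FEx f
     (FConj (FFun (\<lambda>x. FElem x y) f i)
     (FConj (FAll i (FImp (FElem i y) (FAll (i + 1) (FImp (FIn (TPair (TVar i) (TVar (i + 1))) f) (FLess (TVar (i + 1)) (TVar s))))))
     (FConj (FAll i (FImp (FElem i y) (FAll (i + 1) (FImp (FElem (i + 1) y) (FAll (i + 2)
        (FImp (FConj (FIn (TPair (TVar i) (TVar (i + 2))) f) (FIn (TPair (TVar (i + 1)) (TVar (i + 2))) f))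
          (FEq (TVar i) (TVar (i + 1)))))))))
     (FAll (i + 1) (FImp (FLess (TVar (i + 1)) (TVar s)) (FEx i (FConj (FElem i y) (FIn (TPair (TVar i) (TVar (i + 1))) f)))))))))"

text \<open>Bijectivity is split into range, injectivity and surjectivity, each stated for the
  graph, a form that \<open>FCard\<close> copies clause by clause.\<close>

lemma card_is_rel:
  "card_is M y s \<longleftrightarrow> (\<exists>f. is_fun M f (ext M y) \<and>
     (\<forall>x\<in>ext M y. \<forall>v. pair M x v \<in> ext M f \<longrightarrow> Less M v s) \<and>
     (\<forall>x\<in>ext M y. \<forall>x'\<in>ext M y. \<forall>v. pair M x v \<in> ext M f \<and> pair M x' v \<in> ext M f \<longrightarrow> x = x') \<and>
     (\<forall>v. Less M v s \<longrightarrow> (\<exists>x\<in>ext M y. pair M x v \<in> ext M f)))"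
proof -
  have "bij_betw (app M f) (ext M y) (seg M s) \<longleftrightarrow>
     (\<forall>x\<in>ext M y. \<forall>v. pair M x v \<in> ext M f \<longrightarrow> Less M v s) \<and>
     (\<forall>x\<in>ext M y. \<forall>x'\<in>ext M y. \<forall>v. pair M x v \<in> ext M f \<and> pair M x' v \<in> ext M f \<longrightarrow> x = x') \<and>
     (\<forall>v. Less M v s \<longrightarrow> (\<exists>x\<in>ext M y. pair M x v \<in> ext M f))"
    if "is_fun M f (ext M y)" for f
  proof -
    have *: "pair M x v \<in> ext M f \<longleftrightarrow> app M f x = v" if "x \<in> ext M y" for x v
      by (rule app_eq_iff[OF \<open>is_fun M f (ext M y)\<close> that, symmetric])
    have "inj_on (app M f) (ext M y) \<longleftrightarrow>
        (\<forall>x\<in>ext M y. \<forall>x'\<in>ext M y. \<forall>v. pair M x v \<in> ext M f \<and> pair M x' v \<in> ext M f \<longrightarrow> x = x')"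
      by (auto simp: inj_on_def *)
    moreover have "app M f ` ext M y = seg M s \<longleftrightarrow>
        (\<forall>x\<in>ext M y. app M f x \<in> seg M s) \<and> (\<forall>v\<in>seg M s. v \<in> app M f ` ext M y)"
      by (auto simp del: image_iff)
    moreover have "(\<forall>x\<in>ext M y. app M f x \<in> seg M s) \<longleftrightarrow>
        (\<forall>x\<in>ext M y. \<forall>v. pair M x v \<in> ext M f \<longrightarrow> Less M v s)"
      by (simp add: * seg_def)
    moreover have "v \<in> app M f ` ext M y \<longleftrightarrow> (\<exists>x\<in>ext M y. pair M x v \<in> ext M f)" for v
      by (auto simp: *)
    then have "(\<forall>v\<in>seg M s. v \<in> app M f ` ext M y) \<longleftrightarrow>
        (\<forall>v. Less M v s \<longrightarrow> (\<exists>x\<in>ext M y. pair M x v \<in> ext M f))"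
      by (simp add: seg_def)
    ultimately show ?thesis by (simp only: bij_betw_def) argo
  qed
  then show ?thesis unfolding card_is_def by (simp cong: conj_cong)
qed

lemma sat_FCard [simp]: "sat M e (FCard y s) \<longleftrightarrow> card_is M (e y) (e s)"
  unfolding card_is_rel by (simp add: FCard_def Let_def sat_FFun[where D = "ext M (e y)"] Ball_def Bex_def)

section \<open>Bounded quantification, sums and factorials as formulas\<close>

definition FIff :: "fm \<Rightarrow> fm \<Rightarrow> fm" where "FIff \<phi> \<psi> = FConj (FImp \<phi> \<psi>) (FImp \<psi> \<phi>)"

lemma sat_FIff [simp]: "sat M e (FIff \<phi> \<psi>) \<longleftrightarrow> (sat M e \<phi> \<longleftrightarrow> sat M e \<psi>)"
  by (auto simp: FIff_def)

definition FAllB :: "nat \<Rightarrow> tm \<Rightarrow> fm \<Rightarrow> fm" where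
  "FAllB i t \<phi> = FAll i (FImp (FLess (TVar i) t) \<phi>)"

definition FExB :: "nat \<Rightarrow> tm \<Rightarrow> fm \<Rightarrow> fm" where
  "FExB i t \<phi> = FEx i (FConj (FLess (TVar i) t) \<phi>)"

definition FAllE :: "nat \<Rightarrow> nat \<Rightarrow> fm \<Rightarrow> fm" where
  "FAllE i y \<phi> = FAll i (FImp (FElem i y) \<phi>)"

lemma sat_FAllB [simp]:
  "tm_bound t < i \<Longrightarrow> sat M e (FAllB i t \<phi>) \<longleftrightarrow> (\<forall>a\<in>seg M (tval M e t). sat M (e(i := a)) \<phi>)"
  by (simp add: FAllB_def seg_def)

lemma sat_FExB [simp]:
  "tm_bound t < i \<Longrightarrow> sat M e (FExB i t \<phi>) \<longleftrightarrow> (\<exists>a\<in>seg M (tval M e t). sat M (e(i := a)) \<phi>)"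
  by (simp add: FExB_def seg_def)

lemma sat_FAllE [simp]:
  "y < i \<Longrightarrow> sat M e (FAllE i y \<phi>) \<longleftrightarrow> (\<forall>a\<in>ext M (e y). sat M (e(i := a)) \<phi>)"
  by (simp add: FAllE_def Ball_def)

text \<open>The order facts that place \<open>0\<close>, \<open>x\<close> and, for \<open>i\<close>
  below \<open>x\<close>, both \<open>i\<close> and \<open>i + 1\<close> in the domain of a sequence
  of partial sums or products, where \<open>app_eq_iff\<close> applies.\<close>

definition segments_ok :: "'m arith \<Rightarrow> bool" where
  "segments_ok M \<longleftrightarrow> (\<forall>i x. Less M (Zero M) (Add M x (One M)) \<and> Less M x (Add M x (One M)) \<and>
     (Less M i x \<longrightarrow> Less M i (Add M x (One M)) \<and> Less M (Add M i (One M)) (Add M x (One M))))"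

lemma models_segments_ok:
  assumes "models_true_arithmetic M"
  shows "segments_ok M"
proof -
  let ?\<phi> = "FAll 0 (FAll 1 (FConj (FLess TZero (TAdd (TVar 1) TOne))
     (FConj (FLess (TVar 1) (TAdd (TVar 1) TOne)) (FImp (FLess (TVar 0) (TVar 1))
     (FConj (FLess (TVar 0) (TAdd (TVar 1) TOne)) (FLess (TAdd (TVar 0) TOne) (TAdd (TVar 1) TOne)))))))"
  have "sat M (\<lambda>_. Zero M) ?\<phi>"
    by (rule transfer[OF assms]) (simp add: std_arith_def)
  then show ?thesis
    by (simp add: segments_ok_def)
qed

definition FSum :: "(nat \<Rightarrow> nat \<Rightarrow> fm) \<Rightarrow> nat \<Rightarrow> nat \<Rightarrow> nat \<Rightarrow> fm" where
  "FSum \<Phi> x s i = FEx i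
     (FConj (FFun (\<lambda>j. FLess (TVar j) (TAdd (TVar x) TOne)) i (Suc i))
     (FConj (FIn (TPair TZero TZero) i)
     (FConj (FAllB (Suc i) (TVar x) (FEx (Suc (Suc i)) (FConj (\<Phi> (Suc i) (Suc (Suc i)))
        (FEx (Suc (Suc (Suc i))) (FConj (FIn (TPair (TVar (Suc i)) (TVar (Suc (Suc (Suc i))))) i)
          (FIn (TPair (TAdd (TVar (Suc i)) TOne) (TAdd (TVar (Suc (Suc (Suc i)))) (TVar (Suc (Suc i))))) i))))))
     (FIn (TPair (TVar x) (TVar s)) i))))"

text \<open>Application is again traded for membership; the value of \<open>g\<close> at
  \<open>i\<close> becomes the extra witness \<open>u\<close>.\<close>

lemma sum_is_rel:
  assumes "segments_ok M"
  shows "sum_is M F x s \<longleftrightarrow> (\<exists>g. is_fun M g (seg M (Add M x (One M))) \<and>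
     pair M (Zero M) (Zero M) \<in> ext M g \<and>
     (\<forall>i\<in>seg M x. \<exists>v. F i v \<and> (\<exists>u. pair M i u \<in> ext M g \<and>
        pair M (Add M i (One M)) (Add M u v) \<in> ext M g)) \<and>
     pair M x s \<in> ext M g)"
proof -
  have 1: "Zero M \<in> seg M (Add M x (One M))" "x \<in> seg M (Add M x (One M))"
    and 2: "\<And>i. i \<in> seg M x \<Longrightarrow> i \<in> seg M (Add M x (One M)) \<and> Add M i (One M) \<in> seg M (Add M x (One M))"
    using assms unfolding segments_ok_def seg_def by auto
  show ?thesis
    unfolding sum_is_def
    by (intro iff_exI conj_cong ball_cong refl) (simp_all add: app_eq_iff[symmetric] 1 2)
qed

text \<open>The summand formula stands below the binders of the sequence \<open>g\<close>, the index
  \<open>j\<close> and the value \<open>v\<close>, so it is evaluated with these three variables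
  reassigned.\<close>

lemma sat_FSum:
  assumes "segments_ok M" "x < i" "s < i"
    and "\<And>g j v. sat M (e(i := g, Suc i := j, Suc (Suc i) := v)) (\<Phi> (Suc i) (Suc (Suc i))) \<longleftrightarrow> F j v"
  shows "sat M e (FSum \<Phi> x s i) \<longleftrightarrow> sum_is M F (e x) (e s)"
  using assms(2,3) unfolding sum_is_rel[OF assms(1)]
  by (simp add: FSum_def assms(4) sat_FFun[where D = "seg M (Add M (e x) (One M))"] seg_def)

definition FFact :: "nat \<Rightarrow> nat \<Rightarrow> fm" where
  "FFact x y = (let i = Suc (x + y) in FEx i
     (FConj (FFun (\<lambda>j. FLess (TVar j) (TAdd (TVar x) TOne)) i (Suc i))
     (FConj (FIn (TPair TZero TOne) i)
     (FConj (FAllB (Suc i) (TVar x)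
        (FEx (Suc (Suc i)) (FConj (FIn (TPair (TVar (Suc i)) (TVar (Suc (Suc i)))) i)
          (FIn (TPair (TAdd (TVar (Suc i)) TOne) (TMul (TVar (Suc (Suc i))) (TAdd (TVar (Suc i)) TOne))) i))))
     (FIn (TPair (TVar x) (TVar y)) i)))))"

lemma fact_is_rel:
  assumes "segments_ok M"
  shows "fact_is M x y \<longleftrightarrow> (\<exists>g. is_fun M g (seg M (Add M x (One M))) \<and>
     pair M (Zero M) (One M) \<in> ext M g \<and>
     (\<forall>i\<in>seg M x. \<exists>u. pair M i u \<in> ext M g \<and>
        pair M (Add M i (One M)) (Mul M u (Add M i (One M))) \<in> ext M g) \<and>
     pair M x y \<in> ext M g)"
proof -
  have 1: "Zero M \<in> seg M (Add M x (One M))" "x \<in> seg M (Add M x (One M))"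
    and 2: "\<And>i. i \<in> seg M x \<Longrightarrow> i \<in> seg M (Add M x (One M)) \<and> Add M i (One M) \<in> seg M (Add M x (One M))"
    using assms unfolding segments_ok_def seg_def by auto
  show ?thesis
    unfolding fact_is_def
    by (intro iff_exI conj_cong ball_cong refl) (simp_all add: app_eq_iff[symmetric] 1 2)
qed

lemma sat_FFact:
  assumes "segments_ok M"
  shows "sat M e (FFact x y) \<longleftrightarrow> fact_is M (e x) (e y)"
  unfolding fact_is_rel[OF assms]
  by (simp add: FFact_def Let_def sat_FFun[where D = "seg M (Add M (e x) (One M))"] seg_def)

definition FFactQuot :: "nat \<Rightarrow> nat \<Rightarrow> nat \<Rightarrow> fm" where
  "FFactQuot d k r = (let i = Suc (d + k + r) in FEx i (FEx (Suc i) (FEx (Suc (Suc i))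
     (FConj (FEq (TAdd (TVar i) (TVar k)) (TVar d))
     (FConj (FFact d (Suc i))
     (FConj (FFact i (Suc (Suc i)))
       (FEq (TMul (TVar r) (TVar (Suc (Suc i)))) (TVar (Suc i)))))))))"

lemma sat_FFactQuot:
  assumes "segments_ok M"
  shows "sat M e (FFactQuot d k r) \<longleftrightarrow> fact_quot_is M (e d) (e k) (e r)"
  unfolding fact_quot_is_def by (simp add: FFactQuot_def Let_def sat_FFact[OF assms])

section \<open>Formulas for conditions and arrays\<close>

definition FCardLe :: "nat \<Rightarrow> nat \<Rightarrow> fm" where
  "FCardLe y k = (let i = Suc (y + k) in FEx i (FConj (FCard y i) (FLe (TVar i) (TVar k))))"

lemma sat_FCardLe [simp]: "sat M e (FCardLe y k) \<longleftrightarrow> card_le M (e y) (e k)"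
  by (simp add: FCardLe_def Let_def card_le_def)

definition FPartialInj :: "nat \<Rightarrow> nat \<Rightarrow> fm" where
  "FPartialInj n x = (let i = Suc (n + x) in
     FConj (FAllE i x (FExB (Suc i) (TAdd (TVar n) TOne) (FExB (Suc (Suc i)) (TVar n)
       (FEq (TVar i) (TPair (TVar (Suc i)) (TVar (Suc (Suc i))))))))
     (FConj (FAll i (FAll (Suc i) (FAll (Suc (Suc i)) (FImp
        (FConj (FIn (TPair (TVar i) (TVar (Suc i))) x) (FIn (TPair (TVar i) (TVar (Suc (Suc i)))) x))
        (FEq (TVar (Suc i)) (TVar (Suc (Suc i))))))))
     (FAll i (FAll (Suc i) (FAll (Suc (Suc i)) (FImp
        (FConj (FIn (TPair (TVar i) (TVar (Suc (Suc i)))) x) (FIn (TPair (TVar (Suc i)) (TVar (Suc (Suc i)))) x))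
        (FEq (TVar i) (TVar (Suc i)))))))))"

lemma sat_FPartialInj [simp]: "sat M e (FPartialInj n x) \<longleftrightarrow> partial_inj M (e n) (e x)"
  by (simp add: FPartialInj_def Let_def partial_inj_def)

text \<open>The class of conditions is not first-order definable, since the exponent bounding their size
  is standard. Hence compatibility and arrays are recast with the size bounds as explicit parameters.\<close>

definition union_inj :: "'m arith \<Rightarrow> 'm \<Rightarrow> 'm \<Rightarrow> 'm \<Rightarrow> bool" where
  "union_inj M n \<sigma> \<tau> \<longleftrightarrow> (\<exists>\<rho>. partial_inj M n \<rho> \<and> ext M \<rho> = ext M \<sigma> \<union> ext M \<tau>)"

definition FUnionInj :: "nat \<Rightarrow> nat \<Rightarrow> nat \<Rightarrow> fm" where
  "FUnionInj n x y = (let i = Suc (n + x + y) in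
     FEx i (FConj (FPartialInj n i) (FAll (Suc i) (FIff (FElem (Suc i) i) (FDisj (FElem (Suc i) x) (FElem (Suc i) y))))))"

lemma sat_FUnionInj [simp]: "sat M e (FUnionInj n x y) \<longleftrightarrow> union_inj M (e n) (e x) (e y)"
  by (simp add: FUnionInj_def Let_def union_inj_def set_eq_iff)

definition in_entry :: "'m arith \<Rightarrow> 'm \<Rightarrow> 'm \<Rightarrow> 'm \<Rightarrow> 'm \<Rightarrow> bool" where
  "in_entry M A a b \<tau> \<longleftrightarrow> (\<exists>E. pair M (pair M a b) E \<in> ext M A \<and> \<tau> \<in> ext M E)"

definition FInEntry :: "nat \<Rightarrow> nat \<Rightarrow> nat \<Rightarrow> nat \<Rightarrow> fm" where
  "FInEntry A a b x = (let i = Suc (A + a + b + x) in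
     FEx i (FConj (FIn (TPair (TPair (TVar a) (TVar b)) (TVar i)) A) (FElem x i)))"

lemma sat_FInEntry [simp]: "sat M e (FInEntry A a b x) \<longleftrightarrow> in_entry M (e A) (e a) (e b) (e x)"
  by (simp add: FInEntry_def Let_def in_entry_def)

definition grid :: "'m arith \<Rightarrow> 'm \<Rightarrow> 'm set" where
  "grid M m = {pair M a b | a b. a \<in> seg M (Add M m m) \<and> b \<in> seg M m}"

text \<open>The parameter \<open>l\<close> replaces the unspecified standard exponents in the
  completeness clause. Incompatibility is stated contrapositively through
  \<open>union_inj\<close>.\<close>

definition bounded_array :: "'m arith \<Rightarrow> 'm \<Rightarrow> 'm \<Rightarrow> 'm \<Rightarrow> 'm \<Rightarrow> 'm \<Rightarrow> 'm \<Rightarrow> bool" where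
  "bounded_array M n m k \<sigma> A l \<longleftrightarrow>
     is_fun M A (grid M m) \<and>
     (\<forall>a\<in>seg M (Add M m m). \<forall>b\<in>seg M m. \<forall>\<tau>. in_entry M A a b \<tau> \<longrightarrow>
        partial_inj M n \<tau> \<and> card_le M \<tau> k \<and> union_inj M n \<tau> \<sigma> \<and> (\<forall>x\<in>ext M \<tau>. x \<notin> ext M \<sigma>)) \<and>
     (\<forall>a\<in>seg M (Add M m m). \<forall>a'\<in>seg M (Add M m m). \<forall>b\<in>seg M m. a \<noteq> a' \<longrightarrow>
        (\<forall>\<tau>. \<not> (in_entry M A a b \<tau> \<and> in_entry M A a' b \<tau>))) \<and>
     (\<forall>a\<in>seg M (Add M m m). \<forall>b\<in>seg M m. \<forall>b'\<in>seg M m. b \<noteq> b' \<longrightarrow>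
        (\<forall>\<tau>. \<not> (in_entry M A a b \<tau> \<and> in_entry M A a b' \<tau>))) \<and>
     (\<forall>a\<in>seg M (Add M m m). \<forall>a'\<in>seg M (Add M m m). \<forall>b\<in>seg M m. \<forall>\<tau> \<tau>'.
        in_entry M A a b \<tau> \<and> in_entry M A a' b \<tau>' \<and> union_inj M n \<tau> \<tau>' \<longrightarrow> \<tau> = \<tau>') \<and>
     (\<forall>a\<in>seg M (Add M m m). \<forall>b\<in>seg M m. \<forall>b'\<in>seg M m. \<forall>\<tau> \<tau>'.
        in_entry M A a b \<tau> \<and> in_entry M A a b' \<tau>' \<and> union_inj M n \<tau> \<tau>' \<longrightarrow> \<tau> = \<tau>') \<and>
     (\<forall>\<rho> t. partial_inj M n \<rho> \<and> card_is M \<rho> t \<and> le M t l \<and> (\<forall>x\<in>ext M \<sigma>. x \<in> ext M \<rho>) \<longrightarrow>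
        (\<forall>a\<in>seg M (Add M m m). \<exists>b\<in>seg M m. \<exists>\<tau>. in_entry M A a b \<tau> \<and> union_inj M n \<tau> \<rho>))"

definition FGrid :: "nat \<Rightarrow> nat \<Rightarrow> fm" where
  "FGrid m x = (let i = Suc (m + x) in
     FEx i (FEx (Suc i) (FConj (FEq (TVar x) (TPair (TVar i) (TVar (Suc i))))
       (FConj (FLess (TVar i) (TAdd (TVar m) (TVar m))) (FLess (TVar (Suc i)) (TVar m))))))"

lemma sat_FGrid [simp]: "sat M e (FGrid m x) \<longleftrightarrow> e x \<in> grid M (e m)"
  by (simp add: FGrid_def Let_def grid_def seg_def)

definition FArray :: "nat \<Rightarrow> nat \<Rightarrow> nat \<Rightarrow> nat \<Rightarrow> nat \<Rightarrow> nat \<Rightarrow> fm" where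
  "FArray n m k s A l = (let i = Suc (n + m + k + s + A + l);
       a = i; a' = Suc i; b = Suc (Suc i); b' = Suc (Suc (Suc i)); t = Suc b'; t' = Suc t;
       mm = TAdd (TVar m) (TVar m) in
     FConj (FFun (FGrid m) A i)
     (FConj (FAllB a mm (FAllB b (TVar m) (FAll t (FImp (FInEntry A a b t)
         (FConj (FPartialInj n t) (FConj (FCardLe t k) (FConj (FUnionInj n t s)
           (FAllE t' t (FNeg (FElem t' s))))))))))
     (FConj (FAllB a mm (FAllB a' mm (FAllB b (TVar m) (FImp (FNeg (FEq (TVar a) (TVar a')))
         (FAll t (FNeg (FConj (FInEntry A a b t) (FInEntry A a' b t))))))))
     (FConj (FAllB a mm (FAllB b (TVar m) (FAllB b' (TVar m) (FImp (FNeg (FEq (TVar b) (TVar b')))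
         (FAll t (FNeg (FConj (FInEntry A a b t) (FInEntry A a b' t))))))))
     (FConj (FAllB a mm (FAllB a' mm (FAllB b (TVar m) (FAll t (FAll t' (FImp
         (FConj (FInEntry A a b t) (FConj (FInEntry A a' b t') (FUnionInj n t t')))
         (FEq (TVar t) (TVar t'))))))))
     (FConj (FAllB a mm (FAllB b (TVar m) (FAllB b' (TVar m) (FAll t (FAll t' (FImp
         (FConj (FInEntry A a b t) (FConj (FInEntry A a b' t') (FUnionInj n t t')))
         (FEq (TVar t) (TVar t'))))))))
     (FAll a' (FAll t' (FImp (FConj (FPartialInj n a') (FConj (FCard a' t') (FConj (FLe (TVar t') (TVar l))
         (FAllE t s (FElem t a')))))
         (FAllB a mm (FExB b (TVar m) (FEx t (FConj (FInEntry A a b t) (FUnionInj n t a'))))))))))))))"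

lemma sat_FArray [simp]:
  "sat M e (FArray n m k s A l) \<longleftrightarrow> bounded_array M (e n) (e m) (e k) (e s) (e A) (e l)"
proof -
  have *: "sat M e (FFun (FGrid m) A (Suc (n + m + k + s + A + l))) \<longleftrightarrow> is_fun M (e A) (grid M (e m))"
    by (rule sat_FFun) auto
  show ?thesis
    unfolding FArray_def bounded_array_def Let_def by (simp add: *)
qed

text \<open>\<open>m2\<close> stands for \<open>2m\<close>; it is a separate argument because
  \<open>FSum\<close> takes variables, not terms, as bounds.\<close>

definition entries_sum :: "'m arith \<Rightarrow> 'm \<Rightarrow> 'm \<Rightarrow> 'm \<Rightarrow> 'm \<Rightarrow> bool" where
  "entries_sum M m m2 A N \<longleftrightarrow>
     sum_is M (\<lambda>a. sum_is M (\<lambda>b w. \<exists>E. pair M (pair M a b) E \<in> ext M A \<and> card_is M E w) m) m2 N"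

definition FEntriesSum :: "nat \<Rightarrow> nat \<Rightarrow> nat \<Rightarrow> nat \<Rightarrow> fm" where
  "FEntriesSum m m2 A N =
     FSum (\<lambda>a v. FSum (\<lambda>b w. let i = Suc (a + b + w + A) in
        FEx i (FConj (FIn (TPair (TPair (TVar a) (TVar b)) (TVar i)) A) (FCard i w))) m v (Suc (a + v + m + A)))
       m2 N (Suc (m + m2 + A + N))"

lemma sat_FEntriesSum:
  assumes "segments_ok M"
  shows "sat M e (FEntriesSum m m2 A N) \<longleftrightarrow> entries_sum M (e m) (e m2) (e A) (e N)"
  unfolding entries_sum_def FEntriesSum_def
proof (rule sat_FSum[OF assms])
  let ?i = "Suc (m + m2 + A + N)"
  let ?F = "\<lambda>a b w. \<exists>E. pair M (pair M a b) E \<in> ext M (e A) \<and> card_is M E w"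
  fix g j v
  let ?e = "e(?i := g, Suc ?i := j, Suc (Suc ?i) := v)"
  have "sat M ?e (FSum (\<lambda>b w. let i = Suc (Suc ?i + b + w + A) in
        FEx i (FConj (FIn (TPair (TPair (TVar (Suc ?i)) (TVar b)) (TVar i)) A) (FCard i w)))
          m (Suc (Suc ?i)) (Suc (Suc ?i + Suc (Suc ?i) + m + A)))
      \<longleftrightarrow> sum_is M (?F j) (?e m) (?e (Suc (Suc ?i)))"
    by (rule sat_FSum[OF assms]) (simp_all add: Let_def)
  then show "sat M ?e (FSum (\<lambda>b w. let i = Suc (Suc ?i + b + w + A) in
        FEx i (FConj (FIn (TPair (TPair (TVar (Suc ?i)) (TVar b)) (TVar i)) A) (FCard i w)))
          m (Suc (Suc ?i)) (Suc (Suc ?i + Suc (Suc ?i) + m + A)))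
      \<longleftrightarrow> sum_is M (?F j) (e m) v"
    by simp
qed simp_all

text \<open>The combinatorial content as one first-order statement. \<open>l\<close> is the largest
  size at which completeness of the given array is used; the new array is complete up to
  \<open>l' = n - k'\<close>, so that a leaf of \<open>k'\<close> pairs still fits. Derived
  quantities get their own quantifiers because most formula constructors accept only
  variables.\<close>

definition uniformizable :: "'m arith \<Rightarrow> bool" where
  "uniformizable M \<longleftrightarrow> (\<forall>n m k \<sigma> A s k' l.
     k' = Mul M k (Add M k (One M)) \<and> l = Add M s k' \<and> le M l n \<and> partial_inj M n \<sigma> \<and>
     card_is M \<sigma> s \<and> bounded_array M n m k \<sigma> A l \<longrightarrow>
     (\<exists>A' l' m2 N d r. Add M l' k' = n \<and> m2 = Add M m m \<and> bounded_array M n m k' \<sigma> A' l' \<and>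
        (\<forall>a\<in>seg M m2. \<forall>b\<in>seg M m. \<forall>\<tau>. in_entry M A' a b \<tau> \<longrightarrow> card_is M \<tau> k') \<and>
        entries_sum M m m2 A' N \<and> Add M d s = n \<and> fact_quot_is M d k' r \<and>
        le M (Mul M m2 r) N))"

text \<open>Variables 0 to 7 are \<open>n, m, k, \<sigma>, A, s, k', l\<close>; 8 to 13 are
  \<open>A', l', m2, N, d, r\<close>; 14 to 16 are \<open>a, b, \<tau>\<close>.\<close>

definition FUniformizable :: fm where
  "FUniformizable = FAll 0 (FAll 1 (FAll 2 (FAll 3 (FAll 4 (FAll 5 (FAll 6 (FAll 7 (FImp
     (FConj (FEq (TVar 6) (TMul (TVar 2) (TAdd (TVar 2) TOne)))
     (FConj (FEq (TVar 7) (TAdd (TVar 5) (TVar 6)))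
     (FConj (FLe (TVar 7) (TVar 0)) (FConj (FPartialInj 0 3) (FConj (FCard 3 5) (FArray 0 1 2 3 4 7))))))
     (FEx 8 (FEx 9 (FEx 10 (FEx 11 (FEx 12 (FEx 13
       (FConj (FEq (TAdd (TVar 9) (TVar 6)) (TVar 0))
       (FConj (FEq (TVar 10) (TAdd (TVar 1) (TVar 1)))
       (FConj (FArray 0 1 6 3 8 9)
       (FConj (FAllB 14 (TVar 10) (FAllB 15 (TVar 1) (FAll 16 (FImp (FInEntry 8 14 15 16) (FCard 16 6)))))
       (FConj (FEntriesSum 1 10 8 11)
       (FConj (FEq (TAdd (TVar 12) (TVar 5)) (TVar 0))
       (FConj (FFactQuot 12 6 13)
         (FLe (TMul (TVar 10) (TVar 13)) (TVar 11)))))))))))))))))))))))"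

lemma sat_FUniformizable:
  assumes "segments_ok M"
  shows "sat M e FUniformizable \<longleftrightarrow> uniformizable M"
  unfolding FUniformizable_def uniformizable_def
  by (simp add: sat_FEntriesSum[OF assms] sat_FFactQuot[OF assms])

section \<open>Decision trees over a matching\<close>

text \<open>Graphs of partial injections: injectivity of \<open>fst\<close> makes the relation
  single-valued, that of \<open>snd\<close> makes it injective.\<close>

definition matching :: "('a \<times> 'b) set \<Rightarrow> bool" where
  "matching X \<longleftrightarrow> inj_on fst X \<and> inj_on snd X"

lemma matching_subset: "matching Y \<Longrightarrow> X \<subseteq> Y \<Longrightarrow> matching X"
  using inj_on_subset[of fst Y X] inj_on_subset[of snd Y X] by (simp add: matching_def)

lemma matching_fst: "matching X \<Longrightarrow> (p, h) \<in> X \<Longrightarrow> (p, h') \<in> X \<Longrightarrow> h = h'"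
  using inj_onD[of fst X "(p, h)" "(p, h')"] by (simp add: matching_def)

lemma matching_snd: "matching X \<Longrightarrow> (p, h) \<in> X \<Longrightarrow> (p', h) \<in> X \<Longrightarrow> p = p'"
  using inj_onD[of snd X "(p, h)" "(p', h)"] by (simp add: matching_def)

lemma matchingI:
  assumes "\<And>p h h'. (p, h) \<in> X \<Longrightarrow> (p, h') \<in> X \<Longrightarrow> h = h'"
    and "\<And>p p' h. (p, h) \<in> X \<Longrightarrow> (p', h) \<in> X \<Longrightarrow> p = p'"
  shows "matching X"
  unfolding matching_def
proof
  show "inj_on fst X"
  proof (rule inj_onI)
    show "x = y" if "x \<in> X" "y \<in> X" "fst x = fst y" for x y
      using that assms(1)[of "fst x" "snd x" "snd y"] by (cases x; cases y) simp
  qed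
  show "inj_on snd X"
  proof (rule inj_onI)
    show "x = y" if "x \<in> X" "y \<in> X" "snd x = snd y" for x y
      using that assms(2)[of "fst x" "snd x" "fst y"] by (cases x; cases y) simp
  qed
qed

lemma matching_insert:
  assumes "matching X" "p \<notin> fst ` X" "h \<notin> snd ` X"
  shows "matching (insert (p, h) X)"
proof (rule matchingI)
  have 1: "(p, u) \<notin> X" and 2: "(v, h) \<notin> X" for u v
    using assms(2,3) by (metis fst_conv image_eqI, metis snd_conv image_eqI)
  show "u = v" if "(q, u) \<in> insert (p, h) X" "(q, v) \<in> insert (p, h) X" for q u v
    using that 1 matching_fst[OF assms(1), of q u v] by auto
  show "u = v" if "(u, q) \<in> insert (p, h) X" "(v, q) \<in> insert (p, h) X" for q u v
    using that 2 matching_snd[OF assms(1), of u q v] by auto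
qed

text \<open>\<open>leaves P H j \<rho> L\<close>: \<open>L\<close> is the set of leaves of a decision tree with root \<open>\<rho>\<close> all of whose
  branches make exactly \<open>j\<close> queries, each asking for the partner of a fresh element of \<open>P\<close> or \<open>H\<close>.\<close>

inductive leaves :: "'a set \<Rightarrow> 'b set \<Rightarrow> nat \<Rightarrow> ('a \<times> 'b) set \<Rightarrow> ('a \<times> 'b) set set \<Rightarrow> bool"
  for P :: "'a set" and H :: "'b set" where
  leaf: "leaves P H 0 \<rho> {\<rho>}"
| query_fst: "p \<in> P - fst ` \<rho> \<Longrightarrow> (\<And>h. h \<in> H - snd ` \<rho> \<Longrightarrow> leaves P H j (insert (p, h) \<rho>) (f h)) \<Longrightarrow>
    leaves P H (Suc j) \<rho> (\<Union>h\<in>H - snd ` \<rho>. f h)"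
| query_snd: "h \<in> H - snd ` \<rho> \<Longrightarrow> (\<And>p. p \<in> P - fst ` \<rho> \<Longrightarrow> leaves P H j (insert (p, h) \<rho>) (g p)) \<Longrightarrow>
    leaves P H (Suc j) \<rho> (\<Union>p\<in>P - fst ` \<rho>. g p)"

lemma ex_fresh:
  assumes "finite B" "card B < card A"
  obtains x where "x \<in> A - B"
  using assms by (metis DiffI card_mono not_le subsetI)

lemma card_UN_ge:
  assumes "finite I" "\<And>i. i \<in> I \<Longrightarrow> finite (F i) \<and> c \<le> card (F i)"
    and "\<And>i i'. i \<in> I \<Longrightarrow> i' \<in> I \<Longrightarrow> i \<noteq> i' \<Longrightarrow> F i \<inter> F i' = {}" and "d \<le> card I"
  shows "d * c \<le> card (\<Union>i\<in>I. F i)"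
proof -
  have "card (\<Union>i\<in>I. F i) = (\<Sum>i\<in>I. card (F i))"
    using assms by (intro card_UN_disjoint) auto
  also have "\<dots> \<ge> (\<Sum>i\<in>I. c)" using assms by (intro sum_mono) auto
  finally show ?thesis using assms(4) by (simp add: order_trans[OF mult_le_mono1])
qed

text \<open>The first factor is split off rather than the last because induction over trees removes
  the query at the root.\<close>

lemma prod_falling_Suc: "(\<Prod>i<Suc j. (d::nat) - i) = d * (\<Prod>i<j. d - 1 - i)"
  by (subst prod.lessThan_Suc_shift) simp

section \<open>Incompatibility, completeness and number of leaves\<close>

context
  fixes P :: "'a set" and H :: "'b set"
  assumes finite_P: "finite P" and finite_H: "finite H" and card_less: "card H < card P"
begin

definition node :: "('a \<times> 'b) set \<Rightarrow> bool" where
  "node \<rho> \<longleftrightarrow> \<rho> \<subseteq> P \<times> H \<and> matching \<rho>"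

lemma finite_node: "node \<rho> \<Longrightarrow> finite \<rho>"
  unfolding node_def using finite_P finite_H finite_subset by blast

lemma node_insert:
  "node \<rho> \<Longrightarrow> p \<in> P - fst ` \<rho> \<Longrightarrow> h \<in> H - snd ` \<rho> \<Longrightarrow> node (insert (p, h) \<rho>)"
  unfolding node_def by (auto intro!: matching_insert)

lemma card_node_insert: "node \<rho> \<Longrightarrow> p \<in> P - fst ` \<rho> \<Longrightarrow> card (insert (p, h) \<rho>) = Suc (card \<rho>)"
  using finite_node by (subst card_insert_disjoint) (auto simp: image_iff)

lemma card_fst_node: "node \<rho> \<Longrightarrow> card (fst ` \<rho>) = card \<rho>"
  and card_snd_node: "node \<rho> \<Longrightarrow> card (snd ` \<rho>) = card \<rho>"
  unfolding node_def matching_def by (auto intro: card_image)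

lemma leaves_node:
  "leaves P H j \<rho> L \<Longrightarrow> node \<rho> \<Longrightarrow> X \<in> L \<Longrightarrow> \<rho> \<subseteq> X \<and> node X \<and> card X = card \<rho> + j"
proof (induction arbitrary: X rule: leaves.induct)
  case (query_fst p \<rho> j f)
  then obtain h where h: "h \<in> H - snd ` \<rho>" "X \<in> f h" by blast
  from query_fst.IH[OF h(1) node_insert[OF query_fst.prems(1) query_fst.hyps(1) h(1)] h(2)]
  show ?case using card_node_insert[OF query_fst.prems(1) query_fst.hyps(1)] by auto
next
  case (query_snd h \<rho> j g)
  then obtain p where p: "p \<in> P - fst ` \<rho>" "X \<in> g p" by blast
  from query_snd.IH[OF p(1) node_insert[OF query_snd.prems(1) p(1) query_snd.hyps(1)] p(2)]
  show ?case using card_node_insert[OF query_snd.prems(1) p(1)] by auto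
qed simp

text \<open>Both leaves answer the root query. If their union is a matching, the answers coincide,
  so both lie in the same subtree and the induction continues there.\<close>

lemma leaves_incompatible:
  "leaves P H j \<rho> L \<Longrightarrow> node \<rho> \<Longrightarrow> X \<in> L \<Longrightarrow> Y \<in> L \<Longrightarrow> matching (X \<union> Y) \<Longrightarrow> X = Y"
proof (induction arbitrary: X Y rule: leaves.induct)
  case (query_fst p \<rho> j f)
  obtain h where h: "h \<in> H - snd ` \<rho>" "X \<in> f h" using query_fst.prems by blast
  obtain h' where h': "h' \<in> H - snd ` \<rho>" "Y \<in> f h'" using query_fst.prems by blast
  note ins = node_insert[OF query_fst.prems(1) query_fst.hyps(1)]
  have "(p, h) \<in> X" using leaves_node[OF query_fst.hyps(2)[OF h(1)] ins[OF h(1)] h(2)] by blast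
  moreover have "(p, h') \<in> Y" using leaves_node[OF query_fst.hyps(2)[OF h'(1)] ins[OF h'(1)] h'(2)] by blast
  ultimately have "h = h'" using matching_fst[OF query_fst.prems(4)] by blast
  then show ?case using query_fst.IH[OF h(1) ins[OF h(1)] h(2)] h' query_fst.prems(4) by blast
next
  case (query_snd h \<rho> j g)
  obtain p where p: "p \<in> P - fst ` \<rho>" "X \<in> g p" using query_snd.prems by blast
  obtain p' where p': "p' \<in> P - fst ` \<rho>" "Y \<in> g p'" using query_snd.prems by blast
  note ins = node_insert[OF query_snd.prems(1) _ query_snd.hyps(1)]
  have "(p, h) \<in> X" using leaves_node[OF query_snd.hyps(2)[OF p(1)] ins[OF p(1)] p(2)] by blast
  moreover have "(p', h) \<in> Y" using leaves_node[OF query_snd.hyps(2)[OF p'(1)] ins[OF p'(1)] p'(2)] by blast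
  ultimately have "p = p'" using matching_snd[OF query_snd.prems(4)] by blast
  then show ?case using query_snd.IH[OF p(1) ins[OF p(1)] p(2)] p' query_snd.prems(4) by blast
qed simp

text \<open>Walk down along \<open>\<mu>\<close>: if \<open>\<mu>\<close> matches the queried
  vertex, take that answer, otherwise any partner used neither by \<open>\<rho>\<close> nor by
  \<open>\<mu>\<close>. Each query moves one unit from \<open>j\<close> to
  \<open>card \<rho>\<close>, so the size bound is preserved.\<close>

lemma leaves_complete:
  "leaves P H j \<rho> L \<Longrightarrow> node \<rho> \<Longrightarrow> node \<mu> \<Longrightarrow> matching (\<rho> \<union> \<mu>) \<Longrightarrow>
    card \<mu> + (card \<rho> + j) \<le> card H \<Longrightarrow> \<exists>X\<in>L. matching (X \<union> \<mu>)"
proof (induction rule: leaves.induct)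
  case (query_fst p \<rho> j f)
  have "\<exists>h\<in>H - snd ` \<rho>. matching (insert (p, h) \<rho> \<union> \<mu>)"
  proof (cases "p \<in> fst ` \<mu>")
    case True
    then obtain h where h: "(p, h) \<in> \<mu>" by auto
    \<comment> \<open>Were \<open>h\<close> used in \<open>\<rho>\<close>, compatibility with
      \<open>\<mu>\<close> would make \<open>p\<close> its partner there, but \<open>p\<close> is
      fresh.\<close>
    have "h \<notin> snd ` \<rho>"
    proof
      assume "h \<in> snd ` \<rho>"
      then obtain q where "(q, h) \<in> \<rho>" by auto
      with h have "q = p" using matching_snd[OF query_fst.prems(3), of q h p] by blast
      with \<open>(q, h) \<in> \<rho>\<close> show False using query_fst.hyps(1) by force
    qed
    moreover have "h \<in> H" using h query_fst.prems(2) by (auto simp: node_def)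
    moreover have "insert (p, h) \<rho> \<union> \<mu> = \<rho> \<union> \<mu>" using h by auto
    ultimately show ?thesis using query_fst.prems(3) by (intro bexI[of _ h]) auto
  next
    case False
    have "card (snd ` \<rho> \<union> snd ` \<mu>) \<le> card \<rho> + card \<mu>"
      using card_Un_le[of "snd ` \<rho>" "snd ` \<mu>"] card_snd_node query_fst.prems(1,2) by simp
    \<comment> \<open>Strict because one query is still pending: the bound is assumed for
      \<open>Suc j\<close>.\<close>
    also have "\<dots> < card H" using query_fst.prems(4) by simp
    finally obtain h where h: "h \<in> H - (snd ` \<rho> \<union> snd ` \<mu>)"
      using ex_fresh finite_node query_fst.prems(1,2) by (metis finite_Un finite_imageI)
    have "matching (insert (p, h) (\<rho> \<union> \<mu>))"
      using False h query_fst.hyps(1) query_fst.prems(3) by (intro matching_insert) auto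
    then show ?thesis using h by auto
  qed
  then obtain h where h: "h \<in> H - snd ` \<rho>" "matching (insert (p, h) \<rho> \<union> \<mu>)" by blast
  have "card \<mu> + (card (insert (p, h) \<rho>) + j) \<le> card H"
    using card_node_insert[OF query_fst.prems(1) query_fst.hyps(1)] query_fst.prems(4) by simp
  from query_fst.IH[OF h(1) node_insert[OF query_fst.prems(1) query_fst.hyps(1) h(1)] query_fst.prems(2) h(2) this] h(1)
  show ?case by blast
next
  case (query_snd h \<rho> j g)
  have "\<exists>p\<in>P - fst ` \<rho>. matching (insert (p, h) \<rho> \<union> \<mu>)"
  proof (cases "h \<in> snd ` \<mu>")
    case True
    then obtain p where p: "(p, h) \<in> \<mu>" by auto
    have "p \<notin> fst ` \<rho>"
    proof
      assume "p \<in> fst ` \<rho>"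
      then obtain q where "(p, q) \<in> \<rho>" by auto
      with p have "q = h" using matching_fst[OF query_snd.prems(3), of p q h] by blast
      with \<open>(p, q) \<in> \<rho>\<close> show False using query_snd.hyps(1) by force
    qed
    moreover have "p \<in> P" using p query_snd.prems(2) by (auto simp: node_def)
    moreover have "insert (p, h) \<rho> \<union> \<mu> = \<rho> \<union> \<mu>" using p by auto
    ultimately show ?thesis using query_snd.prems(3) by (intro bexI[of _ p]) auto
  next
    case False
    have "card (fst ` \<rho> \<union> fst ` \<mu>) \<le> card \<rho> + card \<mu>"
      using card_Un_le[of "fst ` \<rho>" "fst ` \<mu>"] card_fst_node query_snd.prems(1,2) by simp
    also have "\<dots> < card P" using query_snd.prems(4) card_less by simp
    finally obtain p where p: "p \<in> P - (fst ` \<rho> \<union> fst ` \<mu>)"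
      using ex_fresh finite_node query_snd.prems(1,2) by (metis finite_Un finite_imageI)
    have "matching (insert (p, h) (\<rho> \<union> \<mu>))"
      using False p query_snd.hyps(1) query_snd.prems(3) by (intro matching_insert) auto
    then show ?thesis using p by auto
  qed
  then obtain p where p: "p \<in> P - fst ` \<rho>" "matching (insert (p, h) \<rho> \<union> \<mu>)" by blast
  have "card \<mu> + (card (insert (p, h) \<rho>) + j) \<le> card H"
    using card_node_insert[OF query_snd.prems(1) p(1)] query_snd.prems(4) by simp
  from query_snd.IH[OF p(1) node_insert[OF query_snd.prems(1) p(1) query_snd.hyps(1)] query_snd.prems(2) p(2) this] p(1)
  show ?case by blast
qed simp

text \<open>At depth \<open>i\<close> at least \<open>card H - card \<rho> - i\<close> answers are
  free, and different answers lead to disjoint sets of leaves, so the counts multiply.\<close>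

lemma leaves_card:
  "leaves P H j \<rho> L \<Longrightarrow> node \<rho> \<Longrightarrow> finite L \<and> (\<Prod>i<j. card H - card \<rho> - i) \<le> card L"
proof (induction rule: leaves.induct)
  case (query_fst p \<rho> j f)
  note ins = node_insert[OF query_fst.prems(1) query_fst.hyps(1)]
  have cc: "card (insert (p, h) \<rho>) = Suc (card \<rho>)" for h
    by (rule card_node_insert[OF query_fst.prems(1) query_fst.hyps(1)])
  have IH: "finite (f h) \<and> (\<Prod>i<j. card H - card \<rho> - 1 - i) \<le> card (f h)" if "h \<in> H - snd ` \<rho>" for h
    using query_fst.IH[OF that ins[OF that]] by (simp add: cc)
  have "(card H - card \<rho>) * (\<Prod>i<j. card H - card \<rho> - 1 - i) \<le> card (\<Union>h\<in>H - snd ` \<rho>. f h)"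
  proof (rule card_UN_ge)
    show "f h \<inter> f h' = {}" if "h \<in> H - snd ` \<rho>" "h' \<in> H - snd ` \<rho>" "h \<noteq> h'" for h h'
    proof (rule ccontr)
      assume "f h \<inter> f h' \<noteq> {}"
      then obtain X where X: "X \<in> f h" "X \<in> f h'" by blast
      have "(p, h) \<in> X" "node X" "(p, h') \<in> X"
        using leaves_node[OF query_fst.hyps(2)[OF that(1)] ins[OF that(1)] X(1)]
          leaves_node[OF query_fst.hyps(2)[OF that(2)] ins[OF that(2)] X(2)] by auto
      then show False using matching_fst[of X p h h'] that(3) by (simp add: node_def)
    qed
    show "card H - card \<rho> \<le> card (H - snd ` \<rho>)"
      using diff_card_le_card_Diff[of "snd ` \<rho>" H] finite_node[OF query_fst.prems]
        card_snd_node[OF query_fst.prems] by simp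
  qed (use IH finite_H in auto)
  then show ?case using IH finite_H unfolding prod_falling_Suc by blast
next
  case (query_snd h \<rho> j g)
  note ins = node_insert[OF query_snd.prems(1) _ query_snd.hyps(1)]
  have IH: "finite (g p) \<and> (\<Prod>i<j. card H - card \<rho> - 1 - i) \<le> card (g p)" if "p \<in> P - fst ` \<rho>" for p
    using query_snd.IH[OF that ins[OF that]] card_node_insert[OF query_snd.prems(1) that] by simp
  have "(card H - card \<rho>) * (\<Prod>i<j. card H - card \<rho> - 1 - i) \<le> card (\<Union>p\<in>P - fst ` \<rho>. g p)"
  proof (rule card_UN_ge)
    show "g p \<inter> g p' = {}" if "p \<in> P - fst ` \<rho>" "p' \<in> P - fst ` \<rho>" "p \<noteq> p'" for p p'
    proof (rule ccontr)
      assume "g p \<inter> g p' \<noteq> {}"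
      then obtain X where X: "X \<in> g p" "X \<in> g p'" by blast
      have "(p, h) \<in> X" "node X" "(p', h) \<in> X"
        using leaves_node[OF query_snd.hyps(2)[OF that(1)] ins[OF that(1)] X(1)]
          leaves_node[OF query_snd.hyps(2)[OF that(2)] ins[OF that(2)] X(2)] by auto
      then show False using matching_snd[of X p h p'] that(3) by (simp add: node_def)
    qed
    have "card P - card \<rho> \<le> card (P - fst ` \<rho>)"
      using diff_card_le_card_Diff[of "fst ` \<rho>" P] finite_node[OF query_snd.prems]
        card_fst_node[OF query_snd.prems] by simp
    \<comment> \<open>Since \<open>H\<close> is smaller than \<open>P\<close>, queries to holes may
      be counted by the same factor as queries to pigeons.\<close>
    then show "card H - card \<rho> \<le> card (P - fst ` \<rho>)" using card_less by linarith
  qed (use IH finite_P in auto)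
  then show ?case using IH finite_P unfolding prod_falling_Suc by blast
qed simp

section \<open>A decision tree refining one row of the array\<close>

context
  fixes S :: "('a \<times> 'b) set set" and k :: nat
  assumes node_S: "\<And>\<tau>. \<tau> \<in> S \<Longrightarrow> node \<tau> \<and> card \<tau> \<le> k"
    and incompatible_S: "\<And>\<tau> \<tau>'. \<tau> \<in> S \<Longrightarrow> \<tau>' \<in> S \<Longrightarrow> matching (\<tau> \<union> \<tau>') \<Longrightarrow> \<tau> = \<tau>'"
    and complete_S: "\<And>\<rho>. node \<rho> \<Longrightarrow> card \<rho> \<le> k * (k + 1) \<Longrightarrow> \<exists>\<tau>\<in>S. matching (\<tau> \<union> \<rho>)"
    and k_le: "k * (k + 1) \<le> card H"
begin

text \<open>\<open>S\<close> is a row of the array read as a set of matchings. Fixing the depth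
  exactly, instead of bounding it, gives all leaves the same size.\<close>

definition decidable :: "nat \<Rightarrow> ('a \<times> 'b) set \<Rightarrow> bool" where
  "decidable j \<rho> \<longleftrightarrow> (\<exists>L. leaves P H j \<rho> L \<and> (\<forall>X\<in>L. \<exists>\<tau>\<in>S. \<tau> \<subseteq> X))"

text \<open>Trees for all answers are chosen simultaneously and hung below the new root
  query.\<close>

lemma decidable_fst:
  assumes "p \<in> P - fst ` \<rho>" "\<And>h. h \<in> H - snd ` \<rho> \<Longrightarrow> decidable j (insert (p, h) \<rho>)"
  shows "decidable (Suc j) \<rho>"
proof -
  obtain f where "\<And>h. h \<in> H - snd ` \<rho> \<Longrightarrow> leaves P H j (insert (p, h) \<rho>) (f h) \<and> (\<forall>X\<in>f h. \<exists>\<tau>\<in>S. \<tau> \<subseteq> X)"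
    using assms(2) unfolding decidable_def by metis
  then show ?thesis
    unfolding decidable_def using leaves.query_fst[OF assms(1), of H j f] by blast
qed

lemma decidable_snd:
  assumes "h \<in> H - snd ` \<rho>" "\<And>p. p \<in> P - fst ` \<rho> \<Longrightarrow> decidable j (insert (p, h) \<rho>)"
  shows "decidable (Suc j) \<rho>"
proof -
  obtain f where "\<And>p. p \<in> P - fst ` \<rho> \<Longrightarrow> leaves P H j (insert (p, h) \<rho>) (f p) \<and> (\<forall>X\<in>f p. \<exists>\<tau>\<in>S. \<tau> \<subseteq> X)"
    using assms(2) unfolding decidable_def by metis
  then show ?thesis
    unfolding decidable_def using leaves.query_snd[OF assms(1), of P j f] by blast
qed

text \<open>\<open>\<rho>'\<close> decides every vertex of \<open>\<tau> - \<rho>\<close>. If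
  \<open>\<tau>'\<close> differs from \<open>\<tau>\<close>, they contain different pairs with a
  common vertex, and neither pair lies in \<open>\<rho>\<close>, which is compatible with both.
  \<open>\<rho>'\<close> decides that vertex, and compatibility with \<open>\<tau>'\<close> allows
  only the answer of \<open>\<tau>'\<close>.\<close>

lemma matching_touch:
  assumes "node \<rho>" "\<tau> \<in> S" "\<tau>' \<in> S" "matching (\<tau> \<union> \<rho>)" "matching (\<tau>' \<union> \<rho>)"
    and "\<rho> \<subseteq> \<rho>'" "fst ` (\<tau> - \<rho>) \<subseteq> fst ` \<rho>'" "snd ` (\<tau> - \<rho>) \<subseteq> snd ` \<rho>'" "matching (\<tau>' \<union> \<rho>')"
  shows "\<tau>' \<subseteq> \<rho>' \<or> (\<exists>x\<in>\<tau>' - \<rho>. x \<in> \<rho>')"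
proof (cases "\<tau> = \<tau>'")
  case True
  \<comment> \<open>For \<open>\<tau>' = \<tau>\<close> every missing pigeon is decided in
    \<open>\<rho>'\<close> and can only be matched as in \<open>\<tau>\<close>.\<close>
  have "x \<in> \<rho>'" if "x \<in> \<tau>'" for x
  proof (cases "x \<in> \<rho>")
    case False
    obtain p h where x: "x = (p, h)" by fastforce
    have "p \<in> fst ` \<rho>'" using assms(7) False that True x by force
    then obtain h' where "(p, h') \<in> \<rho>'" by auto
    then show ?thesis using matching_fst[OF assms(9), of p h h'] that x by auto
  qed (use assms(6) in auto)
  then show ?thesis by blast
next
  case False
  have m: "matching \<tau>" "matching \<tau>'" using node_S assms(2,3) by (auto simp: node_def)
  have "\<exists>p h p' h'. (p, h) \<in> \<tau> \<and> (p', h') \<in> \<tau>' \<and> (p, h) \<noteq> (p', h') \<and> (p = p' \<or> h = h')"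
  proof (rule ccontr)
    assume no: "\<not> ?thesis"
    have "matching (\<tau> \<union> \<tau>')"
    proof (rule matchingI)
      show "h = h'" if "(p, h) \<in> \<tau> \<union> \<tau>'" "(p, h') \<in> \<tau> \<union> \<tau>'" for p h h'
        using that no matching_fst[OF m(1), of p h h'] matching_fst[OF m(2), of p h h'] by blast
      show "p = p'" if "(p, h) \<in> \<tau> \<union> \<tau>'" "(p', h) \<in> \<tau> \<union> \<tau>'" for p p' h
        using that no matching_snd[OF m(1), of p h p'] matching_snd[OF m(2), of p h p'] by blast
    qed
    then show False using incompatible_S assms(2,3) False by simp
  qed
  then obtain p h p' h' where ph: "(p, h) \<in> \<tau>" "(p', h') \<in> \<tau>'" "(p, h) \<noteq> (p', h')" "p = p' \<or> h = h'"
    by metis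
  have nr: "(p, h) \<notin> \<rho>"
    using matching_fst[OF assms(5), of p h h'] matching_snd[OF assms(5), of p h p'] ph by blast
  have nr': "(p', h') \<notin> \<rho>"
    using matching_fst[OF assms(4), of p h h'] matching_snd[OF assms(4), of p h p'] ph by blast
  have "p \<in> fst ` \<rho>'" "h \<in> snd ` \<rho>'" using assms(7,8) ph(1) nr by force+
  then obtain q u where "(p, u) \<in> \<rho>'" "(q, h) \<in> \<rho>'" by auto
  then have "(p', h') \<in> \<rho>'"
    using ph matching_fst[OF assms(9), of p u h'] matching_snd[OF assms(9), of q h p'] by auto
  then show ?thesis using nr' ph(2) by blast
qed

text \<open>Querying all vertices of one compatible member of \<open>S\<close> shortens, for every other member,
  the part that is still undecided, because distinct members of \<open>S\<close> disagree somewhere.\<close>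

lemma decidable_from:
  assumes "node \<rho>" "card \<rho> + r * (r + 1) \<le> k * (k + 1)"
    and "\<And>\<tau>. \<tau> \<in> S \<Longrightarrow> matching (\<tau> \<union> \<rho>) \<Longrightarrow> card (\<tau> - \<rho>) \<le> r"
  shows "decidable (r * (r + 1)) \<rho>"
  using assms
proof (induction r arbitrary: \<rho>)
  case 0
  \<comment> \<open>With \<open>r = 0\<close> a compatible member has no pair outside
    \<open>\<rho>\<close>, so \<open>\<rho>\<close> itself serves as the leaf.\<close>
  obtain \<tau> where \<tau>: "\<tau> \<in> S" "matching (\<tau> \<union> \<rho>)" using complete_S[of \<rho>] 0 by auto
  then have "\<tau> \<subseteq> \<rho>" using 0(3)[OF \<tau>] node_S finite_node by auto
  then show ?case
    unfolding decidable_def using leaves.leaf[of P H \<rho>] \<tau>(1) by auto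
next
  case (Suc r)
  \<comment> \<open>The identity \<open>(r + 1)(r + 2) = 2(r + 1) + r(r + 1)\<close> splits the
    budget into this round and the remaining ones.\<close>
  have K: "card \<rho> + 2 * Suc r + r * (r + 1) \<le> k * (k + 1)" using Suc.prems(2) by simp
  obtain \<tau> where \<tau>: "\<tau> \<in> S" "matching (\<tau> \<union> \<rho>)"
    using complete_S[OF Suc.prems(1)] K by auto
  \<comment> \<open>The vertices of \<open>\<tau>\<close> still to be decided: at most
    \<open>Suc r\<close> pigeons and as many holes, whence \<open>2 * Suc r\<close> queries.\<close>
  define A where "A = fst ` (\<tau> - \<rho>)"
  define B where "B = snd ` (\<tau> - \<rho>)"
  have fin: "finite \<tau>" using node_S[OF \<tau>(1)] finite_node by blast
  have AP: "A \<subseteq> P" and BH: "B \<subseteq> H" using node_S[OF \<tau>(1)] by (auto simp: A_def B_def node_def)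
  have "card A \<le> card (\<tau> - \<rho>)" "card B \<le> card (\<tau> - \<rho>)"
    using fin by (auto simp: A_def B_def intro: card_image_le)
  then have AB: "card A + card B \<le> 2 * Suc r" using Suc.prems(3)[OF \<tau>] by simp
  have finAB: "finite A" "finite B" using fin by (auto simp: A_def B_def)
  \<comment> \<open>Induction on the number \<open>q\<close> of queries left in this round, which
    always bounds the number of undecided vertices of \<open>\<tau>\<close>;
    \<open>card \<rho>' + q\<close> stays constant.\<close>
  have "decidable (q + r * (r + 1)) \<rho>'"
    if "q \<le> 2 * Suc r" "\<rho> \<subseteq> \<rho>'" "node \<rho>'" "card \<rho>' + q = card \<rho> + 2 * Suc r"
      "card (A - fst ` \<rho>') + card (B - snd ` \<rho>') \<le> q" for q \<rho>'
    using that
  proof (induction q arbitrary: \<rho>')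
    case 0
    have sub: "A \<subseteq> fst ` \<rho>'" "B \<subseteq> snd ` \<rho>'" using 0(5) finAB by auto
    have "decidable (r * (r + 1)) \<rho>'"
    proof (rule Suc.IH)
      show "card \<rho>' + r * (r + 1) \<le> k * (k + 1)" using 0(4) K by simp
      fix \<tau>' assume \<tau>': "\<tau>' \<in> S" "matching (\<tau>' \<union> \<rho>')"
      then have m: "matching (\<tau>' \<union> \<rho>)" using 0(2) by (auto intro: matching_subset)
      have fin': "finite \<tau>'" using node_S[OF \<tau>'(1)] finite_node by blast
      \<comment> \<open>The gain of the round: \<open>\<rho>'\<close> contains all of
        \<open>\<tau>'\<close> or a pair of it that \<open>\<rho>\<close> lacked, so fewer than
        \<open>Suc r\<close> pairs remain.\<close>
      consider "\<tau>' \<subseteq> \<rho>'" | x where "x \<in> \<tau>' - \<rho>" "x \<in> \<rho>'"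
        using matching_touch[OF Suc.prems(1) \<tau>(1) \<tau>'(1) \<tau>(2) m 0(2)] sub \<tau>'(2)
        unfolding A_def B_def by blast
      then show "card (\<tau>' - \<rho>') \<le> r"
      proof cases
        case 1
        then have "\<tau>' - \<rho>' = {}" by blast
        then show ?thesis by (simp only: card.empty)
      next
        case 2
        have "card (\<tau>' - \<rho>') < card (\<tau>' - \<rho>)"
          using 2 0(2) fin' by (intro psubset_card_mono) auto
        then show ?thesis using Suc.prems(3)[OF \<tau>'(1) m] by simp
      qed
    qed (use 0 in auto)
    then show ?case by simp
  next
    case (Suc q)
    have fr: "finite \<rho>'" using Suc.prems finite_node by blast
    have step: "decidable (q + r * (r + 1)) (insert (p, h) \<rho>')"
      if "p \<in> P - fst ` \<rho>'" "h \<in> H - snd ` \<rho>'"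
        "card (A - fst ` (insert (p, h) \<rho>')) + card (B - snd ` (insert (p, h) \<rho>')) \<le> q" for p h
      using Suc.prems node_insert[OF Suc.prems(3) that(1,2)] card_node_insert[OF Suc.prems(3) that(1)]
      by (intro Suc.IH) (use that(3) in auto)
    have mono: "card (A - fst ` (insert (p, h) \<rho>')) \<le> card (A - fst ` \<rho>')"
      "card (B - snd ` (insert (p, h) \<rho>')) \<le> card (B - snd ` \<rho>')" for p h
      using finAB by (auto intro!: card_mono)
    \<comment> \<open>Query an undecided pigeon or hole of \<open>\<tau>\<close> as long as there is
      one. Its own count drops, and by \<open>mono\<close> the other cannot grow.\<close>
    consider p where "p \<in> A - fst ` \<rho>'" | h where "h \<in> B - snd ` \<rho>'"
      | "A - fst ` \<rho>' = {}" "B - snd ` \<rho>' = {}" by blast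
    then show ?case
    proof cases
      case 1
      have "card (A - fst ` (insert (p, h) \<rho>')) < card (A - fst ` \<rho>')" for h
        using 1 finAB by (intro psubset_card_mono) auto
      then have "decidable (q + r * (r + 1)) (insert (p, h) \<rho>')" if "h \<in> H - snd ` \<rho>'" for h
        using 1 AP that mono(2)[of p h] Suc.prems(5) by (intro step) (auto simp: less_eq_Suc_le dest: order_trans)
      then show ?thesis using decidable_fst[of p] 1 AP by auto
    next
      case 2
      have "card (B - snd ` (insert (p, h) \<rho>')) < card (B - snd ` \<rho>')" for p
        using 2 finAB by (intro psubset_card_mono) auto
      then have "decidable (q + r * (r + 1)) (insert (p, h) \<rho>')" if "p \<in> P - fst ` \<rho>'" for p
        using 2 BH that mono(1)[of p h] Suc.prems(5) by (intro step) (auto simp: less_eq_Suc_le dest: order_trans)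
      then show ?thesis using decidable_snd[of h] 2 BH by auto
    next
      \<comment> \<open>All of \<open>\<tau>\<close> is decided but queries remain: an arbitrary
        fresh pigeon is asked for, which keeps all branches equally long. One exists because the
        budget stays within \<open>card H\<close>.\<close>
      case 3
      have "card (fst ` \<rho>') < card P"
        using card_fst_node[OF Suc.prems(3)] Suc.prems(4) K k_le card_less by simp
      then obtain p where p: "p \<in> P - fst ` \<rho>'" using ex_fresh fr by blast
      have "decidable (q + r * (r + 1)) (insert (p, h) \<rho>')" if "h \<in> H - snd ` \<rho>'" for h
      proof (rule step[OF p that])
        have "A - fst ` (insert (p, h) \<rho>') = {}" "B - snd ` (insert (p, h) \<rho>') = {}" using 3 by auto
        then show "card (A - fst ` (insert (p, h) \<rho>')) + card (B - snd ` (insert (p, h) \<rho>')) \<le> q"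
          by (simp only: card.empty)
      qed
      then show ?thesis using decidable_fst[OF p] by simp
    qed
  qed
  from this[of "2 * Suc r" \<rho>] have "decidable (2 * Suc r + r * (r + 1)) \<rho>"
    using Suc.prems(1) AB card_mono[of A "A - fst ` \<rho>"] card_mono[of B "B - snd ` \<rho>"] finAB by force
  moreover have "2 * Suc r + r * (r + 1) = Suc r * (Suc r + 1)" by simp
  ultimately show ?case by (simp only:)
qed

text \<open>At the empty node nothing is decided and each member of \<open>S\<close> has at most
  \<open>k\<close> pairs, so the tree is started there with \<open>r = k\<close>; \<open>S'\<close>
  is its set of leaves.\<close>

lemma ex_uniform_refinement:
  obtains S' where "finite S'"
    "\<And>X. X \<in> S' \<Longrightarrow> node X \<and> card X = k * (k + 1) \<and> (\<exists>\<tau>\<in>S. \<tau> \<subseteq> X)"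
    "\<And>X Y. X \<in> S' \<Longrightarrow> Y \<in> S' \<Longrightarrow> matching (X \<union> Y) \<Longrightarrow> X = Y"
    "\<And>\<mu>. node \<mu> \<Longrightarrow> card \<mu> + k * (k + 1) \<le> card H \<Longrightarrow> \<exists>X\<in>S'. matching (X \<union> \<mu>)"
    "(\<Prod>i<k * (k + 1). card H - i) \<le> card S'"
proof -
  have e: "node {}" by (simp add: node_def matching_def)
  have "decidable (k * (k + 1)) {}"
    by (rule decidable_from) (use node_S e in auto)
  then obtain L where L: "leaves P H (k * (k + 1)) {} L" "\<And>X. X \<in> L \<Longrightarrow> \<exists>\<tau>\<in>S. \<tau> \<subseteq> X"
    unfolding decidable_def by blast
  show thesis
  proof (rule that[of L])
    show "finite L" "(\<Prod>i<k * (k + 1). card H - i) \<le> card L" using leaves_card[OF L(1) e] by auto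
    show "node X \<and> card X = k * (k + 1) \<and> (\<exists>\<tau>\<in>S. \<tau> \<subseteq> X)" if "X \<in> L" for X
      using leaves_node[OF L(1) e that] L(2)[OF that] by simp
    show "X = Y" if "X \<in> L" "Y \<in> L" "matching (X \<union> Y)" for X Y
      using leaves_incompatible[OF L(1) e that] .
    show "\<exists>X\<in>L. matching (X \<union> \<mu>)" if "node \<mu>" "card \<mu> + k * (k + 1) \<le> card H" for \<mu>
      using leaves_complete[OF L(1) e that(1)] that by (simp add: node_def)
  qed
qed

end

end

section \<open>The standard model\<close>

lemma std_arith_simps [simp]:
  "Zero std_arith = 0" "One std_arith = 1" "Half std_arith x = x div 2"
  "Len std_arith x = nat (bitlen (int x))" "Add std_arith x y = x + y" "Mul std_arith x y = x * y"
  "Smash std_arith x y = 2 ^ (nat (bitlen (int x)) * nat (bitlen (int y)))"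
  "Less std_arith x y \<longleftrightarrow> x < y"
  by (simp_all add: std_arith_def)

lemma segments_ok_std: "segments_ok std_arith"
  by (simp add: segments_ok_def)

lemma le_std [simp]: "le std_arith x y \<longleftrightarrow> x \<le> y"
  by (auto simp: le_def)

lemma seg_std [simp]: "seg std_arith x = {..<x}"
  by (auto simp: seg_def)

lemma pow_std_std [simp]: "pow_std std_arith x c = x ^ c"
  by (induction c) auto

lemma numeral_in_std [simp]: "numeral_in std_arith c = c"
  by (induction c) auto

text \<open>\<open>prod_encode\<close> adds its first component to the triangular number,
  \<open>pair\<close> its second; hence the swap.\<close>

lemma pair_std [simp]: "pair std_arith x y = prod_encode (y, x)"
  by (simp add: pair_def prod_encode_def triangle_def add.commute)

text \<open>Makes \<open>\<one> \<sharp> z\<close> two to the bit length of \<open>z\<close> in the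
  standard model.\<close>

lemma bitlen_1 [simp]: "bitlen 1 = 1"
  by (simp add: bitlen_def floorlog_def)

text \<open>The decomposition in \<open>elem\<close> cuts \<open>y\<close> at bit \<open>x\<close>:
  the odd number \<open>u + u + 1\<close> is the quotient by \<open>2 ^ x\<close> and
  \<open>v\<close> the remainder.\<close>

lemma ext_std [simp]: "ext std_arith y = set_decode y"
proof -
  have "elem std_arith x y \<longleftrightarrow> odd (y div 2 ^ x)" for x
  proof
    assume "elem std_arith x y"
    then obtain u v where v: "v < 2 ^ x" and y: "y = (u + u + 1) * 2 ^ x + v"
      by (auto simp: elem_def)
    then have "y div 2 ^ x = u + u + 1"
      by (intro div_nat_eqI) (simp_all add: algebra_simps)
    then show "odd (y div 2 ^ x)" by simp
  next
    assume "odd (y div 2 ^ x)"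
    then obtain u where u: "y div 2 ^ x = u + u + 1" by (elim oddE) (simp only: mult_2)
    have "y = (u + u + 1) * 2 ^ x + y mod 2 ^ x"
      using div_mult_mod_eq[of y "2 ^ x"] by (simp only: u)
    \<comment> \<open>A number of bit length \<open>x\<close>: 0 if \<open>x = 0\<close>, otherwise
      two to the power \<open>x - 1\<close>.\<close>
    moreover obtain z where "nat (bitlen (int z)) = x"
    proof (cases x)
      case 0
      then show ?thesis using that[of 0] by simp
    next
      case (Suc w)
      have "bitlen (1 * 2 ^ w) = bitlen 1 + int w" by (rule bitlen_pow2) simp
      then show ?thesis using that[of "2 ^ w"] Suc by simp
    qed
    ultimately show "elem std_arith x y"
      unfolding elem_def by (intro exI[of _ z] exI[of _ u] exI[of _ "y mod 2 ^ x"]) simp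
  qed
  then show ?thesis by (auto simp: ext_def set_decode_def)
qed

text \<open>Every function on a finite set of natural numbers has a code; this supplies the
  bijections, sequences and arrays needed as witnesses.\<close>

lemma is_fun_std_ex:
  assumes "finite D"
  obtains f where "is_fun std_arith f D" "\<And>x. x \<in> D \<Longrightarrow> app std_arith f x = g x"
proof -
  let ?f = "set_encode ((\<lambda>x. prod_encode (g x, x)) ` D)"
  have e: "ext std_arith ?f = (\<lambda>x. prod_encode (g x, x)) ` D" using assms by simp
  have "is_fun std_arith ?f D" unfolding is_fun_def e by auto
  moreover have "app std_arith ?f x = g x" if "x \<in> D" for x
    unfolding app_eq_iff[OF calculation that] e using that by auto
  ultimately show thesis using that by blast
qed

lemma card_is_std [simp]: "card_is std_arith y s \<longleftrightarrow> card (set_decode y) = s"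
proof
  assume "card_is std_arith y s"
  then show "card (set_decode y) = s"
    unfolding card_is_def using bij_betw_same_card by fastforce
next
  assume s: "card (set_decode y) = s"
  obtain h where h: "bij_betw h (set_decode y) {0..<s}"
    using ex_bij_betw_finite_nat[of "set_decode y"] s by auto
  obtain f where "is_fun std_arith f (set_decode y)" "\<And>x. x \<in> set_decode y \<Longrightarrow> app std_arith f x = h x"
    using is_fun_std_ex[OF finite_set_decode] by metis
  then show "card_is std_arith y s"
    unfolding card_is_def using h bij_betw_cong[of "set_decode y" "app std_arith f" h]
    by (auto simp: atLeast0LessThan)
qed

lemma card_le_std [simp]: "card_le std_arith y k \<longleftrightarrow> card (set_decode y) \<le> k"
  by (simp add: card_le_def)

lemma sum_is_std:
  assumes "\<And>i. i < x \<Longrightarrow> F i (f i)"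
  shows "sum_is std_arith F x (\<Sum>i<x. f i)"
proof -
  obtain g where "is_fun std_arith g {..<x + 1}" "\<And>i. i \<in> {..<x + 1} \<Longrightarrow> app std_arith g i = sum f {..<i}"
    by (rule is_fun_std_ex[of "{..<x + 1}" "\<lambda>i. sum f {..<i}"]) auto
  then show ?thesis
    unfolding sum_is_def using assms by (intro exI[of _ g]) auto
qed

lemma fact_is_std: "fact_is std_arith x (fact x)"
proof -
  obtain g where "is_fun std_arith g {..<x + 1}" "\<And>i. i \<in> {..<x + 1} \<Longrightarrow> app std_arith g i = fact i"
    by (rule is_fun_std_ex[of "{..<x + 1}" fact]) auto
  then show ?thesis
    unfolding fact_is_def by (intro exI[of _ g]) (auto simp: algebra_simps)
qed

text \<open>The product is a falling factorial. Passing from \<open>k\<close> to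
  \<open>Suc k\<close> moves the factor \<open>d - k\<close> from \<open>fact (d - k)\<close> into
  the product, so their product stays \<open>fact d\<close>.\<close>

lemma fact_quot_is_std:
  assumes "k \<le> d"
  shows "fact_quot_is std_arith d k (\<Prod>i<k. d - i)"
proof -
  have "(\<Prod>i<k. d - i) * fact (d - k) = (fact d :: nat)"
    using assms
  proof (induction k)
    case (Suc k)
    then have "fact (d - k) = (d - k) * (fact (d - Suc k) :: nat)"
      by (simp add: fact_reduce)
    then show ?case using Suc by (simp add: mult.assoc)
  qed simp
  then show ?thesis
    unfolding fact_quot_is_def using fact_is_std assms
    by (intro exI[of _ "d - k"] exI[of _ "fact d"] exI[of _ "fact (d - k)"]) simp
qed

section \<open>Codes of conditions and their graphs\<close>

definition edges :: "nat \<Rightarrow> (nat \<times> nat) set" where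
  "edges x = {(i, j). prod_encode (j, i) \<in> set_decode x}"

definition edge_code :: "(nat \<times> nat) set \<Rightarrow> nat" where
  "edge_code X = set_encode ((\<lambda>(i, j). prod_encode (j, i)) ` X)"

text \<open>Pairing is onto, so every element of a coded set is the code of a pair and
  \<open>edges\<close> loses nothing.\<close>

lemma set_decode_edges: "set_decode x = (\<lambda>(i, j). prod_encode (j, i)) ` edges x"
proof -
  have "c \<in> (\<lambda>(i, j). prod_encode (j, i)) ` edges x" if "c \<in> set_decode x" for c
    using that by (intro image_eqI[of _ _ "(snd (prod_decode c), fst (prod_decode c))"]) (auto simp: edges_def)
  then show ?thesis by (auto simp: edges_def)
qed

lemma edges_code [simp]: "finite X \<Longrightarrow> edges (edge_code X) = X"
  by (auto simp: edges_def edge_code_def)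

lemma edges_eq_iff: "edges x = edges y \<longleftrightarrow> x = y"
  by (metis set_decode_edges set_decode_inverse)

lemma code_edges [simp]: "edge_code (edges x) = x"
  by (metis edge_code_def set_decode_edges set_decode_inverse)

lemma inj_on_edge: "inj_on (\<lambda>(i, j). prod_encode (j, i)) X"
  by (auto simp: inj_on_def)

lemma card_set_decode: "card (set_decode x) = card (edges x)"
  unfolding set_decode_edges by (rule card_image[OF inj_on_edge])

lemma finite_edges [simp]: "finite (edges x)"
  using finite_set_decode[of x] unfolding set_decode_edges by (rule finite_imageD[OF _ inj_on_edge])

lemma partial_inj_std: "partial_inj std_arith n x \<longleftrightarrow> edges x \<subseteq> {..n} \<times> {..<n} \<and> matching (edges x)"
proof -
  have "(\<forall>p\<in>set_decode x. \<exists>i\<in>{..<n + 1}. \<exists>j\<in>{..<n}. p = prod_encode (j, i)) \<longleftrightarrow> edges x \<subseteq> {..n} \<times> {..<n}"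
    unfolding set_decode_edges by auto
  moreover have "(\<forall>i j j'. (i, j) \<in> edges x \<and> (i, j') \<in> edges x \<longrightarrow> j = j') \<and>
     (\<forall>i i' j. (i, j) \<in> edges x \<and> (i', j) \<in> edges x \<longrightarrow> i = i') \<longleftrightarrow> matching (edges x)"
    using matching_fst[of "edges x"] matching_snd[of "edges x"] matchingI[of "edges x"] by metis
  ultimately show ?thesis
    by (simp add: partial_inj_def edges_def)
qed

text \<open>The union of two finite graphs always has a code, so what remains is that it is a
  partial injection.\<close>

lemma union_inj_std:
  "union_inj std_arith n x y \<longleftrightarrow> edges x \<union> edges y \<subseteq> {..n} \<times> {..<n} \<and> matching (edges x \<union> edges y)"
proof -
  have "set_decode r = set_decode x \<union> set_decode y \<longleftrightarrow> edges r = edges x \<union> edges y" for r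
    unfolding set_decode_edges image_Un[symmetric] by (rule inj_image_eq_iff) (auto simp: inj_on_def)
  then have "union_inj std_arith n x y \<longleftrightarrow> (\<exists>r. partial_inj std_arith n r \<and> edges r = edges x \<union> edges y)"
    by (simp add: union_inj_def)
  also have "\<dots> \<longleftrightarrow> partial_inj std_arith n (edge_code (edges x \<union> edges y))"
    using edges_code[of "edges x \<union> edges y"] edges_eq_iff by (metis finite_UnI finite_edges)
  finally show ?thesis by (simp add: partial_inj_std)
qed

section \<open>Coded arrays and the uniform array over the natural numbers\<close>

lemma grid_std: "grid std_arith m = (\<lambda>(a, b). prod_encode (b, a)) ` ({..<m + m} \<times> {..<m})"
  by (auto simp: grid_def)

text \<open>Because of the swap in \<open>pair_std\<close>, the second component of a decoded index
  is the row and the first the column.\<close>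

lemma code_array_ex:
  obtains A where "is_fun std_arith A (grid std_arith m)"
    "\<And>a b. a < m + m \<Longrightarrow> b < m \<Longrightarrow> prod_encode (E a b, prod_encode (b, a)) \<in> set_decode A"
    "\<And>a b x. a < m + m \<Longrightarrow> b < m \<Longrightarrow> in_entry std_arith A a b x \<longleftrightarrow> x \<in> set_decode (E a b)"
proof -
  let ?g = "\<lambda>c. E (snd (prod_decode c)) (fst (prod_decode c))"
  have "finite (grid std_arith m)" by (simp add: grid_std)
  from is_fun_std_ex[OF this, of ?g] obtain A where
    A: "is_fun std_arith A (grid std_arith m)" "\<And>x. x \<in> grid std_arith m \<Longrightarrow> app std_arith A x = ?g x"
    by blast
  have iff: "prod_encode (v, prod_encode (b, a)) \<in> set_decode A \<longleftrightarrow> v = E a b" if "a < m + m" "b < m" for a b v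
  proof -
    have c: "prod_encode (b, a) \<in> grid std_arith m" using that by (auto simp: grid_std)
    show ?thesis using app_eq_iff[OF A(1) c, of v] A(2)[OF c] by auto
  qed
  show thesis by (rule that[OF A(1)]) (simp_all add: iff in_entry_def)
qed

lemma uniformizable_std: "uniformizable std_arith"
  unfolding uniformizable_def
proof (intro allI impI, elim conjE)
  fix n m k \<sigma> A s k' l :: nat
  assume "k' = Mul std_arith k (Add std_arith k (One std_arith))" "l = Add std_arith s k'" "le std_arith l n"
    and inj_\<sigma>: "partial_inj std_arith n \<sigma>" and "card_is std_arith \<sigma> s"
    and A: "bounded_array std_arith n m k \<sigma> A l"
  then have k': "k' = k * (k + 1)" and l: "l = s + k'" "l \<le> n" and s: "card (edges \<sigma>) = s"
    by (simp_all add: card_set_decode)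
  note A_conjs = A[unfolded bounded_array_def seg_std std_arith_simps]
  note A_row = A_conjs[THEN conjunct2, THEN conjunct2, THEN conjunct1, rule_format]
  note A_col = A_conjs[THEN conjunct2, THEN conjunct2, THEN conjunct2, THEN conjunct1, rule_format]
  note A_row_inc = A_conjs[THEN conjunct2, THEN conjunct2, THEN conjunct2, THEN conjunct2, THEN conjunct1, rule_format]
  note A_col_inc = A_conjs[THEN conjunct2, THEN conjunct2, THEN conjunct2, THEN conjunct2, THEN conjunct2, THEN conjunct1, rule_format]
  \<comment> \<open>Entries as sets of graphs; \<open>I1\<close> to \<open>I6\<close> are the
    clauses of \<open>bounded_array\<close> in this language.\<close>
  define I where "I a b = {edges \<tau> |\<tau>. in_entry std_arith A a b \<tau>}" for a b
  have I1: "X \<subseteq> {..n} \<times> {..<n} \<and> matching X \<and> card X \<le> k \<and> matching (X \<union> edges \<sigma>) \<and> X \<inter> edges \<sigma> = {}"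
    if "a < m + m" "b < m" "X \<in> I a b" for a b X
  proof -
    obtain \<tau> where \<tau>: "X = edges \<tau>" "in_entry std_arith A a b \<tau>" using \<open>X \<in> I a b\<close> by (auto simp: I_def)
    have "partial_inj std_arith n \<tau> \<and> card_le std_arith \<tau> k \<and> union_inj std_arith n \<tau> \<sigma> \<and>
        (\<forall>x\<in>set_decode \<tau>. x \<notin> set_decode \<sigma>)"
      using A that(1,2) \<tau>(2) by (simp add: bounded_array_def)
    then have *: "edges \<tau> \<subseteq> {..n} \<times> {..<n}" "matching (edges \<tau>)" "card (edges \<tau>) \<le> k"
      "matching (edges \<tau> \<union> edges \<sigma>)" "\<forall>x\<in>set_decode \<tau>. x \<notin> set_decode \<sigma>"
      by (simp_all add: partial_inj_std union_inj_std card_set_decode)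
    moreover have "edges \<tau> \<inter> edges \<sigma> = {}" using *(5) unfolding edges_def by blast
    ultimately show ?thesis unfolding \<tau>(1) by simp
  qed
  have I2: "a = a'" if "a < m + m" "a' < m + m" "b < m" "X \<in> I a b" "X \<in> I a' b" for a a' b X
  proof (rule ccontr)
    assume "a \<noteq> a'"
    then have "\<forall>\<tau>. \<not> (in_entry std_arith A a b \<tau> \<and> in_entry std_arith A a' b \<tau>)"
      using A_row[of a a' b] that(1-3) by simp
    then show False using that(4,5) by (auto simp: I_def edges_eq_iff)
  qed
  have I3: "b = b'" if "a < m + m" "b < m" "b' < m" "X \<in> I a b" "X \<in> I a b'" for a b b' X
  proof (rule ccontr)
    assume "b \<noteq> b'"
    then have "\<forall>\<tau>. \<not> (in_entry std_arith A a b \<tau> \<and> in_entry std_arith A a b' \<tau>)"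
      using A_col[of a b b'] that(1-3) by simp
    then show False using that(4,5) by (auto simp: I_def edges_eq_iff)
  qed
  have I4: "X = Y" if "a < m + m" "a' < m + m" "b < m" "X \<in> I a b" "Y \<in> I a' b" "matching (X \<union> Y)" for a a' b X Y
  proof -
    note prems = that
    obtain \<tau> \<tau>' where *: "X = edges \<tau>" "in_entry std_arith A a b \<tau>" "Y = edges \<tau>'" "in_entry std_arith A a' b \<tau>'"
      using prems(4,5) by (auto simp: I_def)
    have "union_inj std_arith n \<tau> \<tau>'"
      using I1[OF that(1,3,4)] I1[OF that(2,3,5)] that(6) * by (simp add: union_inj_std)
    then show ?thesis using A_row_inc[of a a' b \<tau> \<tau>'] prems(1-3) * by simp
  qed
  have I5: "X = Y" if "a < m + m" "b < m" "b' < m" "X \<in> I a b" "Y \<in> I a b'" "matching (X \<union> Y)" for a b b' X Y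
  proof -
    note prems = that
    obtain \<tau> \<tau>' where *: "X = edges \<tau>" "in_entry std_arith A a b \<tau>" "Y = edges \<tau>'" "in_entry std_arith A a b' \<tau>'"
      using prems(4,5) by (auto simp: I_def)
    have "union_inj std_arith n \<tau> \<tau>'"
      using I1[OF that(1,2,4)] I1[OF that(1,3,5)] that(6) * by (simp add: union_inj_std)
    then show ?thesis using A_col_inc[of a b b' \<tau> \<tau>'] prems(1-3) * by simp
  qed
  have I6: "\<exists>b<m. \<exists>X\<in>I a b. matching (X \<union> Z)"
    if "a < m + m" "Z \<subseteq> {..n} \<times> {..<n}" "matching Z" "edges \<sigma> \<subseteq> Z" "card Z \<le> l" for a Z
  proof -
    have "finite Z" using that(2) finite_subset by blast
    then have e: "edges (edge_code Z) = Z" by simp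
    have "\<forall>x\<in>set_decode \<sigma>. x \<in> set_decode (edge_code Z)"
      using that(4) unfolding set_decode_edges e by auto
    then have "\<exists>b<m. \<exists>\<tau>. in_entry std_arith A a b \<tau> \<and> union_inj std_arith n \<tau> (edge_code Z)"
      using A that e by (simp add: bounded_array_def partial_inj_std card_set_decode Bex_def)
    then show ?thesis unfolding union_inj_std e I_def by blast
  qed

  \<comment> \<open>The pigeons and holes left free by \<open>\<sigma>\<close>; there is one more
    pigeon than holes.\<close>
  define P where "P = {..n} - fst ` edges \<sigma>"
  define H where "H = {..<n} - snd ` edges \<sigma>"
  have \<sigma>: "edges \<sigma> \<subseteq> {..n} \<times> {..<n}" "matching (edges \<sigma>)" using inj_\<sigma> by (simp_all add: partial_inj_std)
  have fin: "finite P" "finite H" by (simp_all add: P_def H_def)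
  have cards: "card P = n + 1 - s" "card H = n - s"
  proof -
    have "card (fst ` edges \<sigma>) = s" "card (snd ` edges \<sigma>) = s"
      using \<sigma>(2) s by (auto simp: matching_def card_image)
    moreover have "fst ` edges \<sigma> \<subseteq> {..n}" "snd ` edges \<sigma> \<subseteq> {..<n}" using \<sigma>(1) by auto
    ultimately show "card P = n + 1 - s" "card H = n - s"
      unfolding P_def H_def by (simp_all add: card_Diff_subset)
  qed
  have lt: "card H < card P" and k'_le: "k * (k + 1) \<le> card H" using l k' cards by auto
  \<comment> \<open>By \<open>nodeI\<close> and \<open>nodeD\<close>, the graphs disjoint from
    \<open>\<sigma>\<close> and compatible with it are exactly the matchings between
    \<open>P\<close> and \<open>H\<close>.\<close>
  have nodeI: "node P H X" if "X \<subseteq> {..n} \<times> {..<n}" "matching (X \<union> edges \<sigma>)" "X \<inter> edges \<sigma> = {}" for X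
  proof -
    have "i \<in> P \<and> j \<in> H" if "(i, j) \<in> X" for i j
    proof -
      have "(i, j') \<notin> edges \<sigma>" for j'
        using matching_fst[OF \<open>matching (X \<union> edges \<sigma>)\<close>, of i j j'] that \<open>X \<inter> edges \<sigma> = {}\<close> by blast
      moreover have "(i', j) \<notin> edges \<sigma>" for i'
        using matching_snd[OF \<open>matching (X \<union> edges \<sigma>)\<close>, of i j i'] that \<open>X \<inter> edges \<sigma> = {}\<close> by blast
      ultimately show ?thesis
        using that \<open>X \<subseteq> {..n} \<times> {..<n}\<close> by (auto simp: P_def H_def)
    qed
    then show ?thesis
      using that(2) fin lt matching_subset[of "X \<union> edges \<sigma>" X] by (auto simp: node_def)
  qed
  have nodeD: "X \<subseteq> {..n} \<times> {..<n} \<and> matching (X \<union> edges \<sigma>) \<and> X \<inter> edges \<sigma> = {}" if "node P H X" for X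
  proof -
    have X: "X \<subseteq> P \<times> H" "matching X" using that fin lt by (auto simp: node_def)
    have 1: "(i, j') \<notin> edges \<sigma>" "(i', j) \<notin> edges \<sigma>" if "(i, j) \<in> X" for i j i' j'
    proof -
      have "i \<notin> fst ` edges \<sigma>" "j \<notin> snd ` edges \<sigma>" using that X(1) by (auto simp: P_def H_def)
      then show "(i, j') \<notin> edges \<sigma>" "(i', j) \<notin> edges \<sigma>"
        using image_eqI[of i fst "(i, j')" "edges \<sigma>"] image_eqI[of j snd "(i', j)" "edges \<sigma>"] by auto
    qed
    have "matching (X \<union> edges \<sigma>)"
    proof (rule matchingI)
      show "j = j'" if "(i, j) \<in> X \<union> edges \<sigma>" "(i, j') \<in> X \<union> edges \<sigma>" for i j j'
        using that 1(1)[of i j j'] 1(1)[of i j' j] matching_fst[OF X(2), of i j j'] matching_fst[OF \<sigma>(2), of i j j']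
        by blast
      show "i = i'" if "(i, j) \<in> X \<union> edges \<sigma>" "(i', j) \<in> X \<union> edges \<sigma>" for i i' j
        using that 1(2)[of i j i'] 1(2)[of i' j i] matching_snd[OF X(2), of i j i'] matching_snd[OF \<sigma>(2), of i j i']
        by blast
    qed
    moreover have "X \<inter> edges \<sigma> = {}" using 1(1) by (auto simp: disjoint_iff)
    moreover have "X \<subseteq> {..n} \<times> {..<n}" using X(1) by (auto simp: P_def H_def)
    ultimately show ?thesis by blast
  qed

  have "\<exists>S'. finite S' \<and>
      (\<forall>X\<in>S'. node P H X \<and> card X = k' \<and> (\<exists>\<tau>\<in>\<Union>b<m. I a b. \<tau> \<subseteq> X)) \<and>
      (\<forall>X\<in>S'. \<forall>Y\<in>S'. matching (X \<union> Y) \<longrightarrow> X = Y) \<and>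
      (\<forall>\<mu>. node P H \<mu> \<and> card \<mu> + k' \<le> card H \<longrightarrow> (\<exists>X\<in>S'. matching (X \<union> \<mu>))) \<and>
      (\<Prod>i<k'. card H - i) \<le> card S'" if a: "a < m + m" for a
  proof -
    define S where "S = (\<Union>b<m. I a b)"
    have 1: "node P H \<tau> \<and> card \<tau> \<le> k" if "\<tau> \<in> S" for \<tau>
      using that I1[OF a] nodeI by (auto simp: S_def)
    have 2: "\<tau> = \<tau>'" if "\<tau> \<in> S" "\<tau>' \<in> S" "matching (\<tau> \<union> \<tau>')" for \<tau> \<tau>'
      using that I5[OF a] by (auto simp: S_def)
    have 3: "\<exists>\<tau>\<in>S. matching (\<tau> \<union> \<mu>)" if \<mu>: "node P H \<mu>" "card \<mu> \<le> k * (k + 1)" for \<mu>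
    proof -
      \<comment> \<open>The reason for the value of \<open>l\<close>: a node of at most
        \<open>k'\<close> pairs joined with \<open>\<sigma>\<close> stays within the completeness
        bound of \<open>A\<close>.\<close>
      have "card (\<mu> \<union> edges \<sigma>) \<le> l"
        using card_Un_le[of \<mu> "edges \<sigma>"] \<mu>(2) l(1) s k' by simp
      then obtain b X where "b < m" "X \<in> I a b" "matching (X \<union> (\<mu> \<union> edges \<sigma>))"
        using I6[OF a, of "\<mu> \<union> edges \<sigma>"] nodeD[OF \<mu>(1)] \<sigma>(1) by auto
      then show ?thesis
        using matching_subset[of "X \<union> (\<mu> \<union> edges \<sigma>)" "X \<union> \<mu>"] by (auto simp: S_def)
    qed
    show ?thesis
      by (rule ex_uniform_refinement[OF fin lt 1 2 3 k'_le])
        (auto simp: S_def k' intro!: exI)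
  qed
  then obtain S' where S': "\<And>a. a < m + m \<Longrightarrow> finite (S' a) \<and>
      (\<forall>X\<in>S' a. node P H X \<and> card X = k' \<and> (\<exists>\<tau>\<in>\<Union>b<m. I a b. \<tau> \<subseteq> X)) \<and>
      (\<forall>X\<in>S' a. \<forall>Y\<in>S' a. matching (X \<union> Y) \<longrightarrow> X = Y) \<and>
      (\<forall>\<mu>. node P H \<mu> \<and> card \<mu> + k' \<le> card H \<longrightarrow> (\<exists>X\<in>S' a. matching (X \<union> \<mu>))) \<and>
      (\<Prod>i<k'. card H - i) \<le> card (S' a)"
    by metis
  \<comment> \<open>A leaf is put in the column of the old condition it contains;
    \<open>J_col\<close> shows that this column is unique.\<close>
  define J where "J a b = {X \<in> S' a. \<exists>\<tau>\<in>I a b. \<tau> \<subseteq> X}" for a b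
  have J1: "node P H X" "finite X" "card X = k'" if "a < m + m" "X \<in> J a b" for a b X
    using S'[OF that(1)] that(2) finite_node[OF fin lt, of X] by (auto simp: J_def)
  have finJ: "finite (J a b)" if "a < m + m" for a b
    using S'[OF that] by (simp add: J_def)
  have J_cover: "\<exists>b<m. X \<in> J a b" if a: "a < m + m" and X: "X \<in> S' a" for a X
  proof -
    have "\<exists>\<tau>\<in>\<Union>b<m. I a b. \<tau> \<subseteq> X" using S'[OF a] X by blast
    then show ?thesis using X by (auto simp: J_def)
  qed
  have J_same: "X = Y" if "a < m + m" "X \<in> J a b" "Y \<in> J a b'" "matching (X \<union> Y)" for a b b' X Y
    using S'[OF that(1)] that(2-4) by (auto simp: J_def)
  \<comment> \<open>Old conditions inside compatible leaves are compatible, so the clauses for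
    \<open>J\<close> reduce to those for \<open>I\<close>.\<close>
  have J_meet: "\<exists>\<tau>\<in>I a b. \<exists>\<tau>'\<in>I a' b'. matching (\<tau> \<union> \<tau>') \<and> \<tau> \<subseteq> X \<and> \<tau>' \<subseteq> Y"
    if "X \<in> J a b" "Y \<in> J a' b'" "matching (X \<union> Y)" for a a' b b' X Y
  proof -
    note prems = that
    obtain \<tau> \<tau>' where "\<tau> \<in> I a b" "\<tau> \<subseteq> X" "\<tau>' \<in> I a' b'" "\<tau>' \<subseteq> Y"
      using prems by (auto simp: J_def)
    then show ?thesis using matching_subset[OF prems(3), of "\<tau> \<union> \<tau>'"] by blast
  qed
  \<comment> \<open>By \<open>I4\<close> the two old conditions coincide, and by \<open>I2\<close>
    they then sit in the same row.\<close>
  have J_row: "a = a'" if "a < m + m" "a' < m + m" "b < m" "X \<in> J a b" "Y \<in> J a' b" "matching (X \<union> Y)" for a a' b X Y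
    using J_meet[OF that(4-6)] I4[OF that(1-3)] I2[OF that(1-3)] by blast
  have J_col: "b = b'" if "a < m + m" "b < m" "b' < m" "X \<in> J a b" "X \<in> J a b'" for a b b' X
  proof -
    \<comment> \<open>The leaf is compared with itself: the old conditions it contains from both
      entries coincide by \<open>I5\<close>, and \<open>I3\<close> identifies the columns.\<close>
    have "matching (X \<union> X)" using J1(1)[OF that(1,4)] fin lt by (simp add: node_def)
    then show ?thesis using J_meet[OF that(4,5)] I5[OF that(1-3)] I3[OF that(1-3)] by blast
  qed
  define E where "E a b = set_encode (edge_code ` J a b)" for a b
  obtain A' where A': "is_fun std_arith A' (grid std_arith m)"
    "\<And>a b. a < m + m \<Longrightarrow> b < m \<Longrightarrow> prod_encode (E a b, prod_encode (b, a)) \<in> set_decode A'"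
    "\<And>a b x. a < m + m \<Longrightarrow> b < m \<Longrightarrow> in_entry std_arith A' a b x \<longleftrightarrow> x \<in> set_decode (E a b)"
    using code_array_ex[of m E] by blast
  have entry: "in_entry std_arith A' a b x \<longleftrightarrow> edges x \<in> J a b" if "a < m + m" "b < m" for a b x
  proof -
    have "in_entry std_arith A' a b x \<longleftrightarrow> x \<in> edge_code ` J a b"
      using A'(3)[OF that] finJ[OF that(1)] by (simp add: E_def)
    also have "\<dots> \<longleftrightarrow> edges x \<in> J a b"
    proof
      assume "x \<in> edge_code ` J a b"
      then show "edges x \<in> J a b" using J1(2)[OF that(1)] by auto
    next
      assume "edges x \<in> J a b"
      then show "x \<in> edge_code ` J a b" by (intro image_eqI[of _ _ "edges x"]) simp_all
    qed
    finally show ?thesis .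
  qed
  have card_E: "card (set_decode (E a b)) = card (J a b)" if "a < m + m" for a b
  proof -
    have "inj_on edge_code (J a b)"
      by (rule inj_on_inverseI[of _ edges]) (use J1(2)[OF that] in simp)
    then show ?thesis using finJ[OF that] by (simp add: E_def card_image)
  qed
  have "bounded_array std_arith n m k' \<sigma> A' (n - k')"
    unfolding bounded_array_def
  proof (intro conjI)
    show "is_fun std_arith A' (grid std_arith m)" by (rule A'(1))
  next
    show "\<forall>a\<in>seg std_arith (Add std_arith m m). \<forall>b\<in>seg std_arith m. \<forall>\<tau>. in_entry std_arith A' a b \<tau> \<longrightarrow>
        partial_inj std_arith n \<tau> \<and> card_le std_arith \<tau> k' \<and> union_inj std_arith n \<tau> \<sigma> \<and>
        (\<forall>x\<in>ext std_arith \<tau>. x \<notin> ext std_arith \<sigma>)"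
    proof (intro ballI allI impI)
      fix a b \<tau> assume "a \<in> seg std_arith (Add std_arith m m)" "b \<in> seg std_arith m" "in_entry std_arith A' a b \<tau>"
      then have a: "a < m + m" and \<tau>: "edges \<tau> \<in> J a b" using entry by auto
      from J1(1,3)[OF a \<tau>] nodeD[of "edges \<tau>"] \<sigma>(1)
      have "edges \<tau> \<subseteq> {..n} \<times> {..<n}" "matching (edges \<tau> \<union> edges \<sigma>)" "edges \<tau> \<inter> edges \<sigma> = {}"
        "card (edges \<tau>) = k'" by auto
      moreover from this(3) have "\<forall>x\<in>set_decode \<tau>. x \<notin> set_decode \<sigma>"
        unfolding set_decode_edges by auto
      ultimately show "partial_inj std_arith n \<tau> \<and> card_le std_arith \<tau> k' \<and> union_inj std_arith n \<tau> \<sigma> \<and>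
          (\<forall>x\<in>ext std_arith \<tau>. x \<notin> ext std_arith \<sigma>)"
        using \<sigma>(1) matching_subset[of "edges \<tau> \<union> edges \<sigma>" "edges \<tau>"]
        by (simp add: partial_inj_std union_inj_std card_set_decode)
    qed
  next
    have "a = a'" if "a < m + m" "a' < m + m" "b < m" "edges \<tau> \<in> J a b" "edges \<tau> \<in> J a' b" for a a' b \<tau>
      using J_row[OF that(1-5)] J1(1)[OF that(1,4)] fin lt by (simp add: node_def)
    then show "\<forall>a\<in>seg std_arith (Add std_arith m m). \<forall>a'\<in>seg std_arith (Add std_arith m m).
        \<forall>b\<in>seg std_arith m. a \<noteq> a' \<longrightarrow>
        (\<forall>\<tau>. \<not> (in_entry std_arith A' a b \<tau> \<and> in_entry std_arith A' a' b \<tau>))"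
      using entry by (auto simp del: not_less)
  next
    show "\<forall>a\<in>seg std_arith (Add std_arith m m). \<forall>b\<in>seg std_arith m. \<forall>b'\<in>seg std_arith m. b \<noteq> b' \<longrightarrow>
        (\<forall>\<tau>. \<not> (in_entry std_arith A' a b \<tau> \<and> in_entry std_arith A' a b' \<tau>))"
      using entry J_col by auto
  next
    \<comment> \<open>Compatible leaves in one column belong to the same row by
      \<open>J_row\<close>, hence to one tree, whose distinct leaves are incompatible.\<close>
    have "\<tau> = \<tau>'" if "a < m + m" "a' < m + m" "b < m" "edges \<tau> \<in> J a b" "edges \<tau>' \<in> J a' b"
      "matching (edges \<tau> \<union> edges \<tau>')" for a a' b \<tau> \<tau>'
      using J_row[OF that] J_same[OF that(1,4) _ that(6)] that(5) edges_eq_iff by blast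
    then show "\<forall>a\<in>seg std_arith (Add std_arith m m). \<forall>a'\<in>seg std_arith (Add std_arith m m).
        \<forall>b\<in>seg std_arith m. \<forall>\<tau> \<tau>'.
        in_entry std_arith A' a b \<tau> \<and> in_entry std_arith A' a' b \<tau>' \<and> union_inj std_arith n \<tau> \<tau>' \<longrightarrow> \<tau> = \<tau>'"
      using entry by (simp add: union_inj_std)
  next
    have "\<tau> = \<tau>'" if "a < m + m" "edges \<tau> \<in> J a b" "edges \<tau>' \<in> J a b'"
      "matching (edges \<tau> \<union> edges \<tau>')" for a b b' \<tau> \<tau>'
      using J_same[OF that] edges_eq_iff by blast
    then show "\<forall>a\<in>seg std_arith (Add std_arith m m). \<forall>b\<in>seg std_arith m. \<forall>b'\<in>seg std_arith m. \<forall>\<tau> \<tau>'.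
        in_entry std_arith A' a b \<tau> \<and> in_entry std_arith A' a b' \<tau>' \<and> union_inj std_arith n \<tau> \<tau>' \<longrightarrow> \<tau> = \<tau>'"
      using entry by (simp add: union_inj_std) blast
  next
    show "\<forall>\<rho> t. partial_inj std_arith n \<rho> \<and> card_is std_arith \<rho> t \<and> le std_arith t (n - k') \<and>
        (\<forall>x\<in>ext std_arith \<sigma>. x \<in> ext std_arith \<rho>) \<longrightarrow>
        (\<forall>a\<in>seg std_arith (Add std_arith m m). \<exists>b\<in>seg std_arith m. \<exists>\<tau>.
           in_entry std_arith A' a b \<tau> \<and> union_inj std_arith n \<tau> \<rho>)"
    proof (intro allI impI ballI, elim conjE)
      fix \<rho> t a
      assume "partial_inj std_arith n \<rho>" "card_is std_arith \<rho> t" "le std_arith t (n - k')"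
        "\<forall>x\<in>ext std_arith \<sigma>. x \<in> ext std_arith \<rho>" "a \<in> seg std_arith (Add std_arith m m)"
      then have \<rho>: "edges \<rho> \<subseteq> {..n} \<times> {..<n}" "matching (edges \<rho>)" "card (edges \<rho>) \<le> n - k'"
        "edges \<sigma> \<subseteq> edges \<rho>" and a: "a < m + m"
        by (auto simp: partial_inj_std card_set_decode edges_def)
      \<comment> \<open>The tree sees only the part of \<open>\<rho>\<close> outside
        \<open>\<sigma>\<close>. It has at most \<open>n - k' - |\<sigma>|\<close> pairs, which
        leaves room for the \<open>k'\<close> pairs of a leaf.\<close>
      define \<mu> where "\<mu> = edges \<rho> - edges \<sigma>"
      have un: "\<mu> \<union> edges \<sigma> = edges \<rho>" using \<rho>(4) by (auto simp: \<mu>_def)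
      have "node P H \<mu>" using \<rho>(1,2) un by (intro nodeI) (auto simp: \<mu>_def)
      moreover have "card \<mu> + k' \<le> card H"
        using \<rho>(3,4) l s cards(2) by (simp add: \<mu>_def card_Diff_subset)
      ultimately obtain X where X: "X \<in> S' a" "matching (X \<union> \<mu>)" using S'[OF a] by blast
      then obtain b where b: "b < m" "X \<in> J a b" using J_cover[OF a] by blast
      have nX: "node P H X" using J1(1)[OF a b(2)] .
      \<comment> \<open>A clash with \<open>\<rho>\<close> would involve a pair of
        \<open>\<mu>\<close> or of \<open>\<sigma>\<close>; the choice of \<open>X\<close> excludes
        the first, and the second is impossible as \<open>X\<close> avoids all vertices of
        \<open>\<sigma>\<close>.\<close>
      have "matching (X \<union> edges \<rho>)"
      proof (rule matchingI)
        show "j = j'" if "(i, j) \<in> X \<union> edges \<rho>" "(i, j') \<in> X \<union> edges \<rho>" for i j j'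
          using that matching_fst[OF X(2), of i j j'] matching_fst[OF \<rho>(2), of i j j'] nodeD[OF nX]
            matching_fst[of "X \<union> edges \<sigma>" i j j'] un by blast
        show "i = i'" if "(i, j) \<in> X \<union> edges \<rho>" "(i', j) \<in> X \<union> edges \<rho>" for i i' j
          using that matching_snd[OF X(2), of i j i'] matching_snd[OF \<rho>(2), of i j i'] nodeD[OF nX]
            matching_snd[of "X \<union> edges \<sigma>" i j i'] un by blast
      qed
      moreover have "edges (edge_code X) = X" using J1(2)[OF a b(2)] by simp
      ultimately have "in_entry std_arith A' a b (edge_code X) \<and> union_inj std_arith n (edge_code X) \<rho>"
        using entry[OF a b(1)] b(2) nodeD[OF nX] \<rho>(1) by (simp add: union_inj_std)
      then show "\<exists>b\<in>seg std_arith m. \<exists>\<tau>. in_entry std_arith A' a b \<tau> \<and> union_inj std_arith n \<tau> \<rho>"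
        using b(1) by auto
    qed
  qed
  moreover have "\<forall>a\<in>seg std_arith (m + m). \<forall>b\<in>seg std_arith m. \<forall>\<tau>. in_entry std_arith A' a b \<tau> \<longrightarrow> card_is std_arith \<tau> k'"
    using entry J1(3) by (simp add: card_set_decode)
  moreover have "entries_sum std_arith m (m + m) A' (\<Sum>a<m + m. \<Sum>b<m. card (J a b))"
    unfolding entries_sum_def
  proof (intro sum_is_std)
    fix a b assume "a < m + m" "b < m"
    then show "\<exists>F. pair std_arith (pair std_arith a b) F \<in> ext std_arith A' \<and> card_is std_arith F (card (J a b))"
      using A'(2) card_E by (intro exI[of _ "E a b"]) simp
  qed
  moreover have "fact_quot_is std_arith (n - s) k' (\<Prod>i<k'. card H - i)"
    unfolding cards(2) using l by (intro fact_quot_is_std) simp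
  \<comment> \<open>Each of the \<open>2m\<close> rows contributes at least its number of leaves,
    since every leaf occurs in some column.\<close>
  moreover have "(m + m) * (\<Prod>i<k'. card H - i) \<le> (\<Sum>a<m + m. \<Sum>b<m. card (J a b))"
  proof -
    have "(\<Prod>i<k'. card H - i) \<le> (\<Sum>b<m. card (J a b))" if a: "a < m + m" for a
    proof -
      have "S' a \<subseteq> (\<Union>b<m. J a b)" using J_cover[OF a] by auto
      then have "card (S' a) \<le> card (\<Union>b<m. J a b)" using finJ[OF a] by (intro card_mono) auto
      also have "\<dots> \<le> (\<Sum>b<m. card (J a b))" by (rule card_UN_le) simp
      finally have "card (S' a) \<le> (\<Sum>b<m. card (J a b))" .
      moreover have "(\<Prod>i<k'. card H - i) \<le> card (S' a)" using S'[OF a] by blast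
      ultimately show ?thesis by linarith
    qed
    then show ?thesis using sum_mono[of "{..<m + m}" "\<lambda>_. \<Prod>i<k'. card H - i"] by simp
  qed
  moreover have "n - k' + k' = n" "n - s + s = n" using l by simp_all
  ultimately show "\<exists>A' l' m2 N d r. Add std_arith l' k' = n \<and> m2 = Add std_arith m m \<and>
      bounded_array std_arith n m k' \<sigma> A' l' \<and>
      (\<forall>a\<in>seg std_arith m2. \<forall>b\<in>seg std_arith m. \<forall>\<tau>. in_entry std_arith A' a b \<tau> \<longrightarrow> card_is std_arith \<tau> k') \<and>
      entries_sum std_arith m m2 A' N \<and> Add std_arith d s = n \<and> fact_quot_is std_arith d k' r \<and>
      le std_arith (Mul std_arith m2 r) N"
    by (intro exI conjI[rotated]) (assumption | simp)+
qed

section \<open>Polylogarithmic bounds\<close>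

text \<open>With \<open>q = L div (c + 1)\<close>, raising \<open>L \<le> (c + 1) * 2 ^ q\<close> to
  the power \<open>c + 1\<close> bounds \<open>L ^ (c + 1)\<close> by
  \<open>(c + 1) ^ (c + 1) * 2 ^ L\<close>. By assumption one factor \<open>L\<close> exceeds or
  equals \<open>2 * (c + 1) ^ (c + 1)\<close>, and the constant cancels.\<close>

lemma power_le_half_exp:
  fixes c L :: nat
  assumes "2 * Suc c ^ Suc c \<le> L"
  shows "2 * L ^ c \<le> 2 ^ L"
proof -
  define q where "q = L div Suc c"
  have "L \<le> Suc c * Suc q"
    using dividend_less_times_div[of "Suc c" L] by (simp add: q_def)
  moreover have "Suc q \<le> 2 ^ q" using less_exp[of q] by (simp only: Suc_le_eq)
  ultimately have "L \<le> Suc c * 2 ^ q" by (meson le_trans mult_le_mono2)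
  then have "L ^ Suc c \<le> (Suc c * 2 ^ q) ^ Suc c" by (rule power_mono) simp
  also have "\<dots> = Suc c ^ Suc c * 2 ^ (q * Suc c)" by (simp only: power_mult_distrib power_mult)
  also have "\<dots> \<le> Suc c ^ Suc c * 2 ^ L"
    by (intro mult_le_mono2 power_increasing) (simp_all only: q_def div_times_less_eq_dividend one_le_numeral)
  finally have 1: "L * L ^ c \<le> Suc c ^ Suc c * 2 ^ L" by (simp only: power_Suc)
  have "2 * Suc c ^ Suc c * L ^ c \<le> L * L ^ c" using assms by (rule mult_le_mono1)
  with 1 have "Suc c ^ Suc c * (2 * L ^ c) \<le> Suc c ^ Suc c * 2 ^ L"
    by (simp only: mult.left_commute mult.assoc)
  moreover have "0 < Suc c ^ Suc c" by simp
  ultimately show ?thesis by (simp only: mult_le_cancel1)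
qed

lemma bitlen_ge: "2 ^ L \<le> n \<Longrightarrow> L \<le> nat (bitlen (int n))"
  using less_power_nat_iff_bitlen[of n L] bitlen_nonneg[of "int n"] by linarith

text \<open>The assumption makes the bit length \<open>L\<close> large enough for
  \<open>2 * L ^ c \<le> 2 ^ L\<close>, and a positive number of bit length \<open>L\<close> is at
  least \<open>2 ^ (L - 1)\<close>.\<close>

lemma bitlen_power_le:
  fixes n c :: nat
  assumes "2 ^ (2 * Suc c ^ Suc c) \<le> n"
  shows "nat (bitlen (int n)) ^ c \<le> n"
proof -
  define L where "L = nat (bitlen (int n))"
  have n: "0 < int n" using assms less_le_trans[of 0 "2 ^ (2 * Suc c ^ Suc c)" n] by simp
  have L: "2 * Suc c ^ Suc c \<le> L" unfolding L_def by (rule bitlen_ge[OF assms])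
  have "0 < L" using L by (cases L) simp_all
  then have "2 * 2 ^ (L - 1) = (2::nat) ^ L" by (cases L) simp_all
  moreover have "2 ^ (L - 1) \<le> n"
  proof -
    have "nat (bitlen (int n) - 1) = L - 1" by (simp add: L_def nat_diff_distrib)
    then have "int (2 ^ (L - 1)) \<le> int n" using bitlen_bounds[OF n] by (simp only: of_nat_power of_nat_numeral)
    then show ?thesis by (simp only: of_nat_le_iff)
  qed
  moreover have "2 * L ^ c \<le> 2 ^ L" by (rule power_le_half_exp[OF L])
  ultimately show ?thesis unfolding L_def by linarith
qed

lemma eventually_bitlen:
  fixes C :: nat
  obtains n0 where "\<And>n. n0 \<le> n \<Longrightarrow> 2 \<le> nat (bitlen (int n)) \<and> nat (bitlen (int n)) ^ C \<le> n"
proof -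
  \<comment> \<open>The summand 4 secures bit length at least 2, the other one is the threshold of
    \<open>bitlen_power_le\<close>.\<close>
  have "2 \<le> nat (bitlen (int n)) \<and> nat (bitlen (int n)) ^ C \<le> n" if "4 + 2 ^ (2 * Suc C ^ Suc C) \<le> n" for n
    using that bitlen_ge[of 2 n] bitlen_power_le[of C n] by simp
  then show thesis using that by blast
qed

text \<open>The additional exponent pays for having two summands, as \<open>L\<close> is at least
  2.\<close>

lemma power_sum_le:
  fixes L :: nat
  assumes "2 \<le> L"
  shows "L ^ c + L ^ d \<le> L ^ (c + d + 1)"
proof -
  have "L ^ c \<le> L ^ (c + d)" "L ^ d \<le> L ^ (c + d)" using assms by (auto intro!: power_increasing)
  then have "L ^ c + L ^ d \<le> 2 * L ^ (c + d)" by simp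
  also have "\<dots> \<le> L * L ^ (c + d)" using assms by (rule mult_le_mono1)
  finally show ?thesis by simp
qed

lemma mult_Suc_le:
  fixes k :: nat
  assumes "2 \<le> L" "k \<le> L ^ c"
  shows "k * (k + 1) \<le> L ^ (2 * c + 1)"
proof -
  have "k * (k + 1) \<le> L ^ c * (L ^ c + 1)" using assms(2) by (intro mult_le_mono) auto
  also have "\<dots> = L ^ (2 * c) + L ^ c" by (simp only: distrib_left mult_1_right mult_2 power_add)
  also have "\<dots> \<le> 2 * L ^ (2 * c)" using power_increasing[of c "2 * c" L] assms(1) by simp
  also have "\<dots> \<le> L * L ^ (2 * c)" using assms(1) by (rule mult_le_mono1)
  finally show ?thesis by simp
qed

section \<open>Size bounds and compatibility in the nonstandard model\<close>

context
  fixes M :: "'m arith" and n :: 'm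
  assumes model: "models_true_arithmetic M" and nonstd: "nonstandard M n"
begin

text \<open>The successor of a numeral below \<open>n\<close> is at most \<open>n\<close>, and
  equality is excluded because \<open>n\<close> is nonstandard.\<close>

lemma numeral_less: "Less M (numeral_in M j) n"
proof (induction j)
  case 0
  have "sat M (\<lambda>_. n) (FLe TZero (TVar 0))" by (rule transfer[OF model]) simp
  moreover have "numeral_in M 0 \<noteq> n" using nonstd unfolding nonstandard_def by blast
  ultimately show ?case by (simp add: le_def)
next
  case (Suc j)
  have "sat M (\<lambda>_. n) (FImp (FLess (TNum j) (TVar 0)) (FLe (TNum (Suc j)) (TVar 0)))"
    by (rule transfer[OF model]) (simp del: TNum.simps)
  then have "le M (numeral_in M (Suc j)) n" using Suc.IH by (simp del: TNum.simps numeral_in.simps)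
  moreover have "numeral_in M (Suc j) \<noteq> n"
    using nonstd unfolding nonstandard_def by blast
  ultimately show ?case by (simp add: le_def)
qed

text \<open>A standard threshold \<open>n0\<close> is named by a numeral, and \<open>n\<close> lies
  above all numerals. Variable 0 is reserved for \<open>n\<close>.\<close>

lemma transfer_eventually:
  assumes "\<And>e. n0 \<le> e 0 \<Longrightarrow> sat std_arith e \<phi>"
  shows "sat M (e(0 := n)) \<phi>"
proof -
  have "sat M (e(0 := n)) (FImp (FLe (TNum n0) (TVar 0)) \<phi>)"
    by (rule transfer[OF model]) (use assms in simp)
  then show ?thesis using numeral_less[of n0] by (simp add: le_def)
qed

lemma bounded_sum:
  assumes "le M s (pow_std M (Len M n) c)" "le M t (pow_std M (Len M n) d)" "le M r (Add M s t)"
  shows "le M r (pow_std M (Len M n) (c + d + 1))"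
proof -
  obtain n0 where n0: "\<And>n. n0 \<le> n \<Longrightarrow> 2 \<le> nat (bitlen (int n)) \<and> nat (bitlen (int n)) ^ 0 \<le> n"
    using eventually_bitlen by blast
  let ?\<phi> = "FImp (FConj (FLe (TVar 1) (TPow (TLen (TVar 0)) c)) (FConj (FLe (TVar 2) (TPow (TLen (TVar 0)) d))
    (FLe (TVar 3) (TAdd (TVar 1) (TVar 2))))) (FLe (TVar 3) (TPow (TLen (TVar 0)) (c + d + 1)))"
  have "sat M ((\<lambda>_. n)(1 := s, 2 := t, 3 := r, 0 := n)) ?\<phi>"
  proof (rule transfer_eventually)
    fix e :: "nat \<Rightarrow> nat" assume "n0 \<le> e 0"
    then have "nat (bitlen (int (e 0))) ^ c + nat (bitlen (int (e 0))) ^ d \<le> nat (bitlen (int (e 0))) ^ (c + d + 1)"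
      using n0 by (intro power_sum_le) simp
    then show "sat std_arith e ?\<phi>" by (auto simp del: TPow.simps pow_std.simps power_Suc)
  qed
  then show ?thesis using assms by (simp del: TPow.simps pow_std.simps)
qed

text \<open>Here nonstandardness makes room: standard powers of the length of \<open>n\<close> lie
  below \<open>n\<close>, so a condition and a branch of \<open>k(k + 1)\<close> queries fit
  together.\<close>

lemma bounded_depth:
  assumes "le M s (pow_std M (Len M n) c)" "le M k (pow_std M (Len M n) d)"
  shows "le M (Add M s (Mul M k (Add M k (One M)))) n"
    and "le M (Mul M k (Add M k (One M))) (pow_std M (Len M n) (2 * d + 1))"
proof -
  \<comment> \<open>The exponent is the one that \<open>power_sum_le\<close> gives for
    \<open>c\<close> and \<open>2 * d + 1\<close>, the latter coming from
    \<open>mult_Suc_le\<close>.\<close>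
  obtain n0 where n0: "\<And>n. n0 \<le> n \<Longrightarrow> 2 \<le> nat (bitlen (int n)) \<and> nat (bitlen (int n)) ^ (c + (2 * d + 1) + 1) \<le> n"
    using eventually_bitlen by blast
  let ?\<phi> = "FImp (FConj (FLe (TVar 1) (TPow (TLen (TVar 0)) c)) (FLe (TVar 2) (TPow (TLen (TVar 0)) d)))
    (FConj (FLe (TAdd (TVar 1) (TMul (TVar 2) (TAdd (TVar 2) TOne))) (TVar 0))
      (FLe (TMul (TVar 2) (TAdd (TVar 2) TOne)) (TPow (TLen (TVar 0)) (2 * d + 1))))"
  have "sat M ((\<lambda>_. n)(1 := s, 2 := k, 0 := n)) ?\<phi>"
  proof (rule transfer_eventually)
    fix e :: "nat \<Rightarrow> nat" assume "n0 \<le> e 0"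
    then have L: "2 \<le> nat (bitlen (int (e 0)))" "nat (bitlen (int (e 0))) ^ (c + (2 * d + 1) + 1) \<le> e 0"
      using n0 by blast+
    have "e 1 + e 2 * (e 2 + 1) \<le> e 0" "e 2 * (e 2 + 1) \<le> nat (bitlen (int (e 0))) ^ (2 * d + 1)"
      if "e 1 \<le> nat (bitlen (int (e 0))) ^ c" "e 2 \<le> nat (bitlen (int (e 0))) ^ d"
      using mult_Suc_le[OF L(1) that(2)] power_sum_le[OF L(1), of c "2 * d + 1"] that(1) L(2) by linarith+
    then show "sat std_arith e ?\<phi>" by (simp del: TPow.simps pow_std.simps power_Suc)
  qed
  then show "le M (Add M s (Mul M k (Add M k (One M)))) n"
    and "le M (Mul M k (Add M k (One M))) (pow_std M (Len M n) (2 * d + 1))"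
    using assms by (simp_all del: TPow.simps pow_std.simps)
qed

lemma le_transfer:
  "le M x y \<Longrightarrow> le M y z \<Longrightarrow> le M x z"
  "le M (Add M x k) (Add M y k) \<Longrightarrow> le M x y"
  "le M k (Mul M k (Add M k (One M)))"
proof -
  let ?e = "\<lambda>i. if i = 0 then x else if i = 1 then y else if i = 2 then z else k"
  have "sat M ?e (FImp (FConj (FLe (TVar 0) (TVar 1)) (FLe (TVar 1) (TVar 2))) (FLe (TVar 0) (TVar 2)))"
    by (rule transfer[OF model]) simp
  then show "le M x y \<Longrightarrow> le M y z \<Longrightarrow> le M x z" by simp
  have "sat M ?e (FImp (FLe (TAdd (TVar 0) (TVar 3)) (TAdd (TVar 1) (TVar 3))) (FLe (TVar 0) (TVar 1)))"
    by (rule transfer[OF model]) simp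
  then show "le M (Add M x k) (Add M y k) \<Longrightarrow> le M x y" by simp
  have "sat M ?e (FLe (TVar 3) (TMul (TVar 3) (TAdd (TVar 3) TOne)))"
    by (rule transfer[OF model]) simp
  then show "le M k (Mul M k (Add M k (One M)))" by simp
qed

text \<open>Cardinalities are counted by bijections inside the model, so both the existence of a
  count for \<open>u\<close> and its bound come by transfer.\<close>

lemma card_union:
  assumes "card_is M x s" "card_is M y t" "ext M u = ext M x \<union> ext M y"
  obtains r where "card_is M u r" "le M r (Add M s t)"
proof -
  let ?\<phi> = "FImp (FConj (FCard 0 3) (FConj (FCard 1 4)
      (FAll 5 (FIff (FElem 5 2) (FDisj (FElem 5 0) (FElem 5 1))))))
    (FEx 5 (FConj (FCard 2 5) (FLe (TVar 5) (TAdd (TVar 3) (TVar 4)))))"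
  have "sat M ((\<lambda>_. x)(1 := y, 2 := u, 3 := s, 4 := t)) ?\<phi>"
  proof (rule transfer[OF model])
    fix e :: "nat \<Rightarrow> nat"
    have "card (set_decode (e 2)) \<le> card (set_decode (e 0)) + card (set_decode (e 1))"
      if "\<forall>a. a \<in> set_decode (e 2) \<longleftrightarrow> a \<in> set_decode (e 0) \<or> a \<in> set_decode (e 1)"
    proof -
      have "set_decode (e 2) = set_decode (e 0) \<union> set_decode (e 1)" using that by auto
      then show ?thesis by (simp add: card_Un_le)
    qed
    then show "sat std_arith e ?\<phi>" by auto
  qed
  then show thesis using assms that by auto
qed

lemma poly_len_bounded_mono: "le M s t \<Longrightarrow> poly_len_bounded M n t \<Longrightarrow> poly_len_bounded M n s"
  unfolding poly_len_bounded_def using le_transfer(1) by blast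

lemma poly_len_bounded_add:
  "poly_len_bounded M n s \<Longrightarrow> poly_len_bounded M n t \<Longrightarrow> poly_len_bounded M n (Add M s t)"
  unfolding poly_len_bounded_def using bounded_sum by (metis le_def)

text \<open>The size restriction in \<open>compat\<close> is automatic: the union of two conditions
  is at most as large as the sum of their sizes, again bounded by a standard power.\<close>

lemma compat_iff_union_inj:
  assumes "x \<in> conds M n" "y \<in> conds M n"
  shows "compat M n x y \<longleftrightarrow> union_inj M n x y"
proof
  assume "compat M n x y"
  then show "union_inj M n x y" by (auto simp: compat_def union_inj_def conds_def)
next
  assume "union_inj M n x y"
  then obtain u where u: "partial_inj M n u" "ext M u = ext M x \<union> ext M y" by (auto simp: union_inj_def)
  obtain s t where st: "card_is M x s" "poly_len_bounded M n s" "card_is M y t" "poly_len_bounded M n t"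
    using assms by (auto simp: conds_def)
  obtain r where "card_is M u r" "le M r (Add M s t)" using card_union[OF st(1,3) u(2)] .
  then have "u \<in> conds M n"
    using u(1) poly_len_bounded_mono poly_len_bounded_add[OF st(2,4)] by (auto simp: conds_def)
  then show "compat M n x y" using u(2) by (auto simp: compat_def)
qed

end

section \<open>Arrays in the model and their first-order form\<close>

lemma in_entry_iff:
  assumes "is_fun M A (grid M m)" "a \<in> seg M (Add M m m)" "b \<in> seg M m"
  shows "in_entry M A a b x \<longleftrightarrow> x \<in> ext M (entry M A a b)"
proof -
  have "pair M a b \<in> grid M m" using assms(2,3) by (auto simp: grid_def)
  note app_iff = app_eq_iff[OF assms(1) this]
  show ?thesis by (simp add: in_entry_def entry_def app_iff[symmetric])
qed

lemma sum_is_cong: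
  assumes "\<And>i v. i \<in> seg M x \<Longrightarrow> F i v = G i v"
  shows "sum_is M F x s \<longleftrightarrow> sum_is M G x s"
  unfolding sum_is_def using assms by (simp cong: ball_cong)

lemma array_size_is_iff:
  assumes "is_fun M A (grid M m)"
  shows "array_size_is M m A N \<longleftrightarrow> entries_sum M m (Add M m m) A N"
  unfolding array_size_is_def entries_sum_def
proof (intro sum_is_cong)
  fix a b w assume "a \<in> seg M (Add M m m)" "b \<in> seg M m"
  then have "pair M a b \<in> grid M m" by (auto simp: grid_def)
  note app_iff = app_eq_iff[OF assms this]
  show "card_is M (entry M A a b) w \<longleftrightarrow> (\<exists>E. pair M (pair M a b) E \<in> ext M A \<and> card_is M E w)"
    by (simp add: entry_def app_iff[symmetric])
qed

theorem theorem4p11: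
  fixes M :: "'m arith" and n \<sigma> m k A :: 'm
  assumes "countable (UNIV :: 'm set)"
    and "models_true_arithmetic M"
    and "nonstandard M n"
    and "\<sigma> \<in> conds M n"
    and "\<exists>c. le M k (pow_std M (Len M n) c)"
    and "wphp_array M n m k \<sigma> A"
  shows "\<exists>k' c' A' N s d r.
           le M k k' \<and> le M k' (pow_std M (Len M n) c') \<and>
           wphp_array M n m k' \<sigma> A' \<and> uniform M m k' A' \<and>
           array_size_is M m A' N \<and>
           card_is M \<sigma> s \<and> Add M d s = n \<and> fact_quot_is M d k' r \<and>
           le M (Mul M (Add M m m) r) N"
proof -
  note model = assms(2,3)
  note compat_iff = compat_iff_union_inj[OF model]
  obtain c2 where k: "le M k (pow_std M (Len M n) c2)" using assms(5) by blast
  obtain s c1 where s: "partial_inj M n \<sigma>" "card_is M \<sigma> s" "le M s (pow_std M (Len M n) c1)"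
    using assms(4) by (auto simp: conds_def poly_len_bounded_def)
  define k' where "k' = Mul M k (Add M k (One M))"
  have k'_bound: "le M k' (pow_std M (Len M n) (2 * c2 + 1))"
    unfolding k'_def by (rule bounded_depth(2)[OF model s(3) k])
  have conds_le: "x \<in> conds M n" if "partial_inj M n x" "card_is M x t" "le M t (pow_std M (Len M n) b)" for x t b
    using that unfolding conds_def poly_len_bounded_def by blast
  note A = assms(6)[unfolded wphp_array_def]
  have A_fun: "is_fun M A (grid M m)" using A by (simp add: grid_def)
  note A_entry = in_entry_iff[OF A_fun]
  have A_cond: "\<tau> \<in> conds M n \<and> card_le M \<tau> k \<and> compat M n \<tau> \<sigma> \<and> ext M \<tau> \<inter> ext M \<sigma> = {}"
    if "a \<in> seg M (Add M m m)" "b \<in> seg M m" "\<tau> \<in> ext M (entry M A a b)" for a b \<tau>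
    using A[THEN conjunct2, THEN conjunct2, THEN conjunct2, THEN conjunct1] that by blast
  have bounded_A: "bounded_array M n m k \<sigma> A (Add M s k')"
    unfolding bounded_array_def
  proof (intro conjI)
    show "is_fun M A (grid M m)" by (rule A_fun)
    show "\<forall>a\<in>seg M (Add M m m). \<forall>b\<in>seg M m. \<forall>\<tau>. in_entry M A a b \<tau> \<longrightarrow>
        partial_inj M n \<tau> \<and> card_le M \<tau> k \<and> union_inj M n \<tau> \<sigma> \<and> (\<forall>x\<in>ext M \<tau>. x \<notin> ext M \<sigma>)"
    proof (intro ballI allI impI)
      fix a b \<tau> assume ab: "a \<in> seg M (Add M m m)" "b \<in> seg M m" and "in_entry M A a b \<tau>"
      then have "\<tau> \<in> conds M n" "card_le M \<tau> k" "compat M n \<tau> \<sigma>" "ext M \<tau> \<inter> ext M \<sigma> = {}"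
        using A_cond[OF ab] A_entry[OF ab] by blast+
      then show "partial_inj M n \<tau> \<and> card_le M \<tau> k \<and> union_inj M n \<tau> \<sigma> \<and> (\<forall>x\<in>ext M \<tau>. x \<notin> ext M \<sigma>)"
        using compat_iff assms(4) by (auto simp: conds_def)
    qed
    show "\<forall>a\<in>seg M (Add M m m). \<forall>a'\<in>seg M (Add M m m). \<forall>b\<in>seg M m. a \<noteq> a' \<longrightarrow>
        (\<forall>\<tau>. \<not> (in_entry M A a b \<tau> \<and> in_entry M A a' b \<tau>))"
      using A[THEN conjunct2, THEN conjunct2, THEN conjunct2, THEN conjunct2, THEN conjunct1]
      by (simp add: A_entry disjoint_iff)
    show "\<forall>a\<in>seg M (Add M m m). \<forall>b\<in>seg M m. \<forall>b'\<in>seg M m. b \<noteq> b' \<longrightarrow>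
        (\<forall>\<tau>. \<not> (in_entry M A a b \<tau> \<and> in_entry M A a b' \<tau>))"
      using A[THEN conjunct2, THEN conjunct2, THEN conjunct2, THEN conjunct2, THEN conjunct2, THEN conjunct1]
      by (simp add: A_entry disjoint_iff)
    show "\<forall>a\<in>seg M (Add M m m). \<forall>a'\<in>seg M (Add M m m). \<forall>b\<in>seg M m. \<forall>\<tau> \<tau>'.
        in_entry M A a b \<tau> \<and> in_entry M A a' b \<tau>' \<and> union_inj M n \<tau> \<tau>' \<longrightarrow> \<tau> = \<tau>'"
    proof (intro ballI allI impI, elim conjE)
      fix a a' b \<tau> \<tau>'
      assume *: "a \<in> seg M (Add M m m)" "a' \<in> seg M (Add M m m)" "b \<in> seg M m"
        "in_entry M A a b \<tau>" "in_entry M A a' b \<tau>'" "union_inj M n \<tau> \<tau>'"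
      then have \<tau>: "\<tau> \<in> ext M (entry M A a b)" "\<tau>' \<in> ext M (entry M A a' b)" by (simp_all add: A_entry)
      have "compat M n \<tau> \<tau>'" using compat_iff A_cond[OF *(1,3) \<tau>(1)] A_cond[OF *(2,3) \<tau>(2)] *(6) by simp
      then show "\<tau> = \<tau>'"
        using A[THEN conjunct2, THEN conjunct2, THEN conjunct2, THEN conjunct2, THEN conjunct2, THEN conjunct2,
            THEN conjunct1] *(1-3) \<tau> by blast
    qed
    show "\<forall>a\<in>seg M (Add M m m). \<forall>b\<in>seg M m. \<forall>b'\<in>seg M m. \<forall>\<tau> \<tau>'.
        in_entry M A a b \<tau> \<and> in_entry M A a b' \<tau>' \<and> union_inj M n \<tau> \<tau>' \<longrightarrow> \<tau> = \<tau>'"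
    proof (intro ballI allI impI, elim conjE)
      fix a b b' \<tau> \<tau>'
      assume *: "a \<in> seg M (Add M m m)" "b \<in> seg M m" "b' \<in> seg M m"
        "in_entry M A a b \<tau>" "in_entry M A a b' \<tau>'" "union_inj M n \<tau> \<tau>'"
      then have \<tau>: "\<tau> \<in> ext M (entry M A a b)" "\<tau>' \<in> ext M (entry M A a b')" by (simp_all add: A_entry)
      have "compat M n \<tau> \<tau>'" using compat_iff A_cond[OF *(1,2) \<tau>(1)] A_cond[OF *(1,3) \<tau>(2)] *(6) by simp
      then show "\<tau> = \<tau>'"
        using A[THEN conjunct2, THEN conjunct2, THEN conjunct2, THEN conjunct2, THEN conjunct2, THEN conjunct2,
            THEN conjunct2, THEN conjunct1] *(1-3) \<tau> by blast
    qed
    show "\<forall>\<rho> t. partial_inj M n \<rho> \<and> card_is M \<rho> t \<and> le M t (Add M s k') \<and> (\<forall>x\<in>ext M \<sigma>. x \<in> ext M \<rho>) \<longrightarrow>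
        (\<forall>a\<in>seg M (Add M m m). \<exists>b\<in>seg M m. \<exists>\<tau>. in_entry M A a b \<tau> \<and> union_inj M n \<tau> \<rho>)"
    proof (intro allI impI ballI, elim conjE)
      fix \<rho> t a
      assume \<rho>: "partial_inj M n \<rho>" "card_is M \<rho> t" "le M t (Add M s k')" "\<forall>x\<in>ext M \<sigma>. x \<in> ext M \<rho>"
        and a: "a \<in> seg M (Add M m m)"
      \<comment> \<open>A set of at most \<open>s + k'\<close> pairs is polynomially bounded, so
        \<open>\<rho>\<close> is a condition and completeness of \<open>A\<close> applies to
        it.\<close>
      have c\<rho>: "\<rho> \<in> conds M n"
        by (rule conds_le[OF \<rho>(1,2) bounded_sum[OF model s(3) k'_bound \<rho>(3)]])
      have "extends M \<rho> \<sigma>" using \<rho>(4) by (auto simp: extends_def)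
      then obtain b \<tau> where b: "b \<in> seg M m" "\<tau> \<in> ext M (entry M A a b)" "compat M n \<tau> \<rho>"
        using A[THEN conjunct2, THEN conjunct2, THEN conjunct2, THEN conjunct2, THEN conjunct2, THEN conjunct2,
            THEN conjunct2, THEN conjunct2] c\<rho> a by blast
      then have "union_inj M n \<tau> \<rho>" using compat_iff A_cond[OF a b(1,2)] c\<rho> by simp
      then show "\<exists>b\<in>seg M m. \<exists>\<tau>. in_entry M A a b \<tau> \<and> union_inj M n \<tau> \<rho>"
        using b(1,2) A_entry[OF a b(1)] by blast
    qed
  qed
  have "le M (Add M s k') n" unfolding k'_def by (rule bounded_depth(1)[OF model s(3) k])
  then have hyps: "k' = Mul M k (Add M k (One M)) \<and> Add M s k' = Add M s k' \<and> le M (Add M s k') n \<and>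
      partial_inj M n \<sigma> \<and> card_is M \<sigma> s \<and> bounded_array M n m k \<sigma> A (Add M s k')"
    using s(1,2) bounded_A k'_def by simp
  have "uniformizable M"
  proof -
    have "sat M (\<lambda>_. n) FUniformizable"
      by (rule transfer[OF assms(2)]) (simp add: sat_FUniformizable[OF segments_ok_std] uniformizable_std)
    then show ?thesis by (simp add: sat_FUniformizable[OF models_segments_ok[OF assms(2)]])
  qed
  from this[unfolded uniformizable_def, THEN spec[of _ n], THEN spec[of _ m], THEN spec[of _ k],
      THEN spec[of _ \<sigma>], THEN spec[of _ A], THEN spec[of _ s], THEN spec[of _ k'],
      THEN spec[of _ "Add M s k'"], THEN mp, OF hyps]
  obtain A' l' m2 N d r where A': "Add M l' k' = n" "m2 = Add M m m" "bounded_array M n m k' \<sigma> A' l'"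
    "\<forall>a\<in>seg M m2. \<forall>b\<in>seg M m. \<forall>\<tau>. in_entry M A' a b \<tau> \<longrightarrow> card_is M \<tau> k'"
    "entries_sum M m m2 A' N" "Add M d s = n" "fact_quot_is M d k' r" "le M (Mul M m2 r) N"
    by (elim exE conjE) (rule that)
  note B = A'(3)[unfolded bounded_array_def]
  have A'_fun: "is_fun M A' (grid M m)" using B by (rule conjunct1)
  note A'_entry = in_entry_iff[OF A'_fun, symmetric]
  \<comment> \<open>All entries have exactly \<open>k'\<close> pairs, a polynomially bounded number,
    so they are conditions.\<close>
  have A'_cond: "\<tau> \<in> conds M n \<and> card_is M \<tau> k' \<and> union_inj M n \<tau> \<sigma> \<and> ext M \<tau> \<inter> ext M \<sigma> = {}"
    if "a \<in> seg M (Add M m m)" "b \<in> seg M m" "in_entry M A' a b \<tau>" for a b \<tau>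
  proof -
    have "partial_inj M n \<tau>" "union_inj M n \<tau> \<sigma>" "\<forall>x\<in>ext M \<tau>. x \<notin> ext M \<sigma>"
      using B[THEN conjunct2, THEN conjunct1] that by blast+
    moreover have "card_is M \<tau> k'" using A'(2,4) that by blast
    ultimately show ?thesis using conds_le[OF _ _ k'_bound] by (auto simp: disjoint_iff simp del: pow_std.simps)
  qed
  have "wphp_array M n m k' \<sigma> A'"
    unfolding wphp_array_def
  proof (intro conjI)
    show "\<sigma> \<in> conds M n" by (rule assms(4))
    show "poly_len_bounded M n k'" using k'_bound unfolding poly_len_bounded_def by blast
    show "is_fun M A' {pair M a b | a b. a \<in> seg M (Add M m m) \<and> b \<in> seg M m}"
      using A'_fun by (simp add: grid_def)
    show "\<forall>a\<in>seg M (Add M m m). \<forall>b\<in>seg M m. \<forall>\<tau>\<in>ext M (entry M A' a b).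
        \<tau> \<in> conds M n \<and> card_le M \<tau> k' \<and> compat M n \<tau> \<sigma> \<and> ext M \<tau> \<inter> ext M \<sigma> = {}"
    proof (intro ballI)
      fix a b \<tau> assume "a \<in> seg M (Add M m m)" "b \<in> seg M m" "\<tau> \<in> ext M (entry M A' a b)"
      then have \<tau>: "\<tau> \<in> conds M n \<and> card_is M \<tau> k' \<and> union_inj M n \<tau> \<sigma> \<and> ext M \<tau> \<inter> ext M \<sigma> = {}"
        using A'_cond by (simp add: A'_entry)
      then have "card_le M \<tau> k'" by (auto simp: card_le_def le_def)
      then show "\<tau> \<in> conds M n \<and> card_le M \<tau> k' \<and> compat M n \<tau> \<sigma> \<and> ext M \<tau> \<inter> ext M \<sigma> = {}"
        using \<tau> compat_iff assms(4) by simp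
    qed
    show "\<forall>a\<in>seg M (Add M m m). \<forall>a'\<in>seg M (Add M m m). \<forall>b\<in>seg M m. a \<noteq> a' \<longrightarrow>
        ext M (entry M A' a b) \<inter> ext M (entry M A' a' b) = {}"
      using B[THEN conjunct2, THEN conjunct2, THEN conjunct1] by (simp add: A'_entry disjoint_iff)
    show "\<forall>a\<in>seg M (Add M m m). \<forall>b\<in>seg M m. \<forall>b'\<in>seg M m. b \<noteq> b' \<longrightarrow>
        ext M (entry M A' a b) \<inter> ext M (entry M A' a b') = {}"
      using B[THEN conjunct2, THEN conjunct2, THEN conjunct2, THEN conjunct1] by (simp add: A'_entry disjoint_iff)
    show "\<forall>a\<in>seg M (Add M m m). \<forall>a'\<in>seg M (Add M m m). \<forall>b\<in>seg M m.
        \<forall>\<tau>\<in>ext M (entry M A' a b). \<forall>\<tau>'\<in>ext M (entry M A' a' b). \<tau> \<noteq> \<tau>' \<longrightarrow> \<not> compat M n \<tau> \<tau>'"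
    proof (intro ballI impI notI)
      fix a a' b \<tau> \<tau>'
      assume *: "a \<in> seg M (Add M m m)" "a' \<in> seg M (Add M m m)" "b \<in> seg M m"
        "\<tau> \<in> ext M (entry M A' a b)" "\<tau>' \<in> ext M (entry M A' a' b)" "\<tau> \<noteq> \<tau>'" "compat M n \<tau> \<tau>'"
      then have \<tau>: "in_entry M A' a b \<tau>" "in_entry M A' a' b \<tau>'" by (simp_all add: A'_entry)
      have "union_inj M n \<tau> \<tau>'" using compat_iff A'_cond[OF *(1,3) \<tau>(1)] A'_cond[OF *(2,3) \<tau>(2)] *(7) by simp
      then show False
        using B[THEN conjunct2, THEN conjunct2, THEN conjunct2, THEN conjunct2, THEN conjunct1] *(1-3,6) \<tau> by blast
    qed
    show "\<forall>a\<in>seg M (Add M m m). \<forall>b\<in>seg M m. \<forall>b'\<in>seg M m.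
        \<forall>\<tau>\<in>ext M (entry M A' a b). \<forall>\<tau>'\<in>ext M (entry M A' a b'). \<tau> \<noteq> \<tau>' \<longrightarrow> \<not> compat M n \<tau> \<tau>'"
    proof (intro ballI impI notI)
      fix a b b' \<tau> \<tau>'
      assume *: "a \<in> seg M (Add M m m)" "b \<in> seg M m" "b' \<in> seg M m"
        "\<tau> \<in> ext M (entry M A' a b)" "\<tau>' \<in> ext M (entry M A' a b')" "\<tau> \<noteq> \<tau>'" "compat M n \<tau> \<tau>'"
      then have \<tau>: "in_entry M A' a b \<tau>" "in_entry M A' a b' \<tau>'" by (simp_all add: A'_entry)
      have "union_inj M n \<tau> \<tau>'" using compat_iff A'_cond[OF *(1,2) \<tau>(1)] A'_cond[OF *(1,3) \<tau>(2)] *(7) by simp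
      then show False
        using B[THEN conjunct2, THEN conjunct2, THEN conjunct2, THEN conjunct2, THEN conjunct2, THEN conjunct1]
          *(1-3,6) \<tau> by blast
    qed
    show "\<forall>\<rho>\<in>conds M n. extends M \<rho> \<sigma> \<longrightarrow>
        (\<forall>a\<in>seg M (Add M m m). \<exists>b\<in>seg M m. \<exists>\<tau>\<in>ext M (entry M A' a b). compat M n \<tau> \<rho>)"
    proof (intro ballI impI)
      fix \<rho> a assume \<rho>: "\<rho> \<in> conds M n" "extends M \<rho> \<sigma>" and a: "a \<in> seg M (Add M m m)"
      obtain t b where t: "partial_inj M n \<rho>" "card_is M \<rho> t" "le M t (pow_std M (Len M n) b)"
        using \<rho>(1) by (auto simp: conds_def poly_len_bounded_def)
      \<comment> \<open>Whatever standard exponent bounds \<open>t\<close>, the sum with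
        \<open>k'\<close> is at most \<open>n = l' + k'\<close>; cancelling \<open>k'\<close> puts
        \<open>\<rho>\<close> within the completeness bound of \<open>A'\<close>.\<close>
      have "le M (Add M t k') (Add M l' k')"
        using bounded_depth(1)[OF model t(3) k] unfolding A'(1) k'_def[symmetric] .
      then have "le M t l'" by (rule le_transfer(2)[OF model])
      then obtain b \<tau> where b: "b \<in> seg M m" "in_entry M A' a b \<tau>" "union_inj M n \<tau> \<rho>"
        using B[THEN conjunct2, THEN conjunct2, THEN conjunct2, THEN conjunct2, THEN conjunct2, THEN conjunct2]
          t(1,2) \<rho>(2) a unfolding extends_def by blast
      then have "compat M n \<tau> \<rho>" using compat_iff A'_cond[OF a b(1,2)] \<rho>(1) by simp
      then show "\<exists>b\<in>seg M m. \<exists>\<tau>\<in>ext M (entry M A' a b). compat M n \<tau> \<rho>"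
        using b(1,2) A'_entry[OF a b(1)] by blast
    qed
  qed
  moreover have "uniform M m k' A'"
    unfolding uniform_def using A'_cond by (simp add: A'_entry)
  moreover have "array_size_is M m A' N"
    using array_size_is_iff[OF A'_fun] A'(2,5) by simp
  moreover have "le M k k'" unfolding k'_def by (rule le_transfer(3)[OF model])
  ultimately show ?thesis
    using k'_bound s(2) A'(2,6,7,8) by blast
qed

end
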